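(* Let $\mathfrak{C}$ be an $(\!(n,k)\!)$ code, i.e. a $2^k$-dimensional subspace of the $n$-qubit Hilbert space $(\mathbb{C}^2)^{\otimes n}$ with $k<n$, and let $d\ge 1$ and $\delta\ge 0$. Let $\varepsilon_{\mathsf g}(\mathfrak{C},d)$ be its subsystem variance with respect to the complete graph $\mathsf g$ on the $n$ qubits (so the maximum is over all sets of at most $d$ qubits). If $\varepsilon_{\mathsf g}(\mathfrak{C},d)+\delta<1$ and $$H_2\!\left(\tfrac{\varepsilon_{\mathsf g}(\mathfrak{C},d)}{2}+\tfrac{\delta}{2}\right)<\frac{k}{n},$$ then every code state $|\psi\rangle\in\mathfrak{C}$ satisfies $\mathscr{C}^{\delta}(\psi)>\log d$, where $\mathscr{C}^\delta$ is the $\delta$-robust all-to-all circuit complexity.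
   Context: Logarithms are base 2 and $H_2(p)=-p\log p-(1-p)\log(1-p)$. For an $(\!(n,k)\!)$ code $\mathfrak{C}$, let $\Gamma=\Pi/2^k$ be the maximally mixed state on $\mathfrak{C}$ ($\Pi$ the projector onto $\mathfrak{C}$). For an adjacency graph $\mathsf G$ on the qubits, the subsystem variance is $\varepsilon_{\mathsf G}(\mathfrak{C},d)=\max\{\|\psi_S-\Gamma_S\|_1 : |\psi\rangle\in\mathfrak{C}\text{ a unit vector}, S\text{ a set of qubits connected in }\mathsf G, |S|\le d\}$, where subscript $S$ denotes the reduced state on $S$ and $\psi=|\psi\rangle\langle\psi|$. The circuit complexity $\mathscr{C}_{\mathsf G}(\psi)$ of a pure state is the minimum $l$ such that $|\psi\rangle=U_l\cdots U_1|0\rangle^{\otimes n}$, where each $U_i$ is a tensor product of 2-qubit unitaries acting on disjoint pairs of qubits that are adjacent in $\mathsf G$. The $\delta$-robust complexity $\mathscr{C}^\delta_{\mathsf G}(\psi)$ is the minimum of $\mathscr{C}_{\mathsf G}(\psi')$ over pure states $\psi'$ with $\|\psi'-\psi\|_1\le\delta$. "All-to-all" means $\mathsf G$ is the complete graph $\mathsf g$, and then $\mathscr{C}^\delta=\mathscr{C}^\delta_{\mathsf g}$. *)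

theory Defs
  imports "HOL-Analysis.Analysis"
begin

text \<open>A computational-basis configuration of a set S of qubits (qubits are natural
numbers) is a bit assignment that is False outside S.  A vector / operator on the
qubits S is a complex function on configurations (resp. pairs of configurations);
only its values on configurations of S are relevant.  The n-qubit register is the
qubit set {0..<n}.\<close>

type_synonym config = "nat \<Rightarrow> bool"
type_synonym qvec = "config \<Rightarrow> complex"
type_synonym qop = "config \<Rightarrow> config \<Rightarrow> complex"

definition cfg :: "nat set \<Rightarrow> config set" where
  "cfg S = {x. \<forall>i. i \<notin> S \<longrightarrow> \<not> x i}"

definition unit_vec :: "nat \<Rightarrow> qvec \<Rightarrow> bool" where
  "unit_vec n \<psi> \<longleftrightarrow> (\<Sum>x\<in>cfg {0..<n}. (cmod (\<psi> x))\<^sup>2) = 1"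

definition inner_q :: "nat \<Rightarrow> qvec \<Rightarrow> qvec \<Rightarrow> complex" where
  "inner_q n \<phi> \<psi> = (\<Sum>x\<in>cfg {0..<n}. cnj (\<phi> x) * \<psi> x)"

definition proj :: "qvec \<Rightarrow> qop" where
  "proj \<psi> = (\<lambda>x y. \<psi> x * cnj (\<psi> y))"

text \<open>Trace norm of an operator on the finite index set I, as the maximum of
|tr(U A)| over unitaries U (equivalently, the sum of the singular values of A).\<close>
definition unitary_on :: "config set \<Rightarrow> qop \<Rightarrow> bool" where
  "unitary_on I U \<longleftrightarrow>
     (\<forall>x\<in>I. \<forall>y\<in>I. (\<Sum>z\<in>I. U x z * cnj (U y z)) = (if x = y then 1 else 0))"

definition trace_norm :: "config set \<Rightarrow> qop \<Rightarrow> real" where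
  "trace_norm I A = Sup ((\<lambda>U. cmod (\<Sum>x\<in>I. \<Sum>y\<in>I. U x y * A y x)) ` {U. unitary_on I U})"

definition merge :: "nat set \<Rightarrow> config \<Rightarrow> config \<Rightarrow> config" where
  "merge S x z = (\<lambda>i. if i \<in> S then x i else z i)"

definition ptrace :: "nat \<Rightarrow> nat set \<Rightarrow> qop \<Rightarrow> qop" where
  "ptrace n S \<rho> = (\<lambda>x y. \<Sum>z\<in>cfg ({0..<n} - S). \<rho> (merge S x z) (merge S y z))"

text \<open>An ((n,k)) code is given by an orthonormal basis b 0, ..., b (2^k - 1) of the
code space; the code space is their span.\<close>
definition is_code :: "nat \<Rightarrow> nat \<Rightarrow> (nat \<Rightarrow> qvec) \<Rightarrow> bool" where
  "is_code n k b \<longleftrightarrow> k < n \<and>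
     (\<forall>i<2^k. \<forall>j<2^k. inner_q n (b i) (b j) = (if i = j then 1 else 0))"

definition in_code :: "nat \<Rightarrow> nat \<Rightarrow> (nat \<Rightarrow> qvec) \<Rightarrow> qvec \<Rightarrow> bool" where
  "in_code n k b \<psi> \<longleftrightarrow> (\<exists>c. \<forall>x\<in>cfg {0..<n}. \<psi> x = (\<Sum>j<2^k. c j * b j x))"

definition code_mixed :: "nat \<Rightarrow> (nat \<Rightarrow> qvec) \<Rightarrow> qop" where
  "code_mixed k b = (\<lambda>x y. (\<Sum>j<2^k. proj (b j) x y) / 2^k)"

text \<open>Subsystem variance with respect to the complete graph on the n qubits:
every set of qubits is connected, so S ranges over all subsets of size at most d.\<close>
definition subsys_var_all :: "nat \<Rightarrow> nat \<Rightarrow> (nat \<Rightarrow> qvec) \<Rightarrow> nat \<Rightarrow> real" where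
  "subsys_var_all n k b d = Sup {trace_norm (cfg S)
        (\<lambda>x y. ptrace n S (proj \<psi>) x y - ptrace n S (code_mixed k b) x y) | \<psi> S.
        in_code n k b \<psi> \<and> unit_vec n \<psi> \<and> S \<subseteq> {0..<n} \<and> card S \<le> d}"

text \<open>A two-qubit gate (a, b, g) acts on the ordered pair of distinct qubits a, b;
g p q p' q' is its matrix entry <p q| G |p' q'>.\<close>
type_synonym gate = "nat \<times> nat \<times> (bool \<Rightarrow> bool \<Rightarrow> bool \<Rightarrow> bool \<Rightarrow> complex)"

definition unitary2 :: "(bool \<Rightarrow> bool \<Rightarrow> bool \<Rightarrow> bool \<Rightarrow> complex) \<Rightarrow> bool" where
  "unitary2 g \<longleftrightarrow> (\<forall>p q p' q'. (\<Sum>r\<in>UNIV. \<Sum>s\<in>UNIV. g p q r s * cnj (g p' q' r s))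
                          = (if p = p' \<and> q = q' then 1 else 0))"

definition gate_op :: "gate \<Rightarrow> qop" where
  "gate_op G = (case G of (a, b, g) \<Rightarrow>
     (\<lambda>x y. if (\<forall>i. i \<noteq> a \<and> i \<noteq> b \<longrightarrow> x i = y i) then g (x a) (x b) (y a) (y b) else 0))"

definition apply_op :: "nat \<Rightarrow> qop \<Rightarrow> qvec \<Rightarrow> qvec" where
  "apply_op n M \<psi> = (\<lambda>x. \<Sum>y\<in>cfg {0..<n}. M x y * \<psi> y)"

definition gate_qubits :: "gate \<Rightarrow> nat set" where
  "gate_qubits G = {fst G, fst (snd G)}"

definition valid_layer :: "nat \<Rightarrow> gate list \<Rightarrow> bool" where
  "valid_layer n gs \<longleftrightarrow>
     (\<forall>G\<in>set gs. fst G < n \<and> fst (snd G) < n \<and> fst G \<noteq> fst (snd G) \<and> unitary2 (snd (snd G))) \<and>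
     (\<forall>i<length gs. \<forall>j<length gs. i \<noteq> j \<longrightarrow> gate_qubits (gs ! i) \<inter> gate_qubits (gs ! j) = {})"

definition apply_layer :: "nat \<Rightarrow> gate list \<Rightarrow> qvec \<Rightarrow> qvec" where
  "apply_layer n gs \<psi> = foldr (\<lambda>G \<phi>. apply_op n (gate_op G) \<phi>) gs \<psi>"

definition apply_circuit :: "nat \<Rightarrow> gate list list \<Rightarrow> qvec \<Rightarrow> qvec" where
  "apply_circuit n ls \<psi> = foldr (apply_layer n) ls \<psi>"

definition ket0 :: qvec where
  "ket0 = (\<lambda>x. if x = (\<lambda>_. False) then 1 else 0)"

definition circuit_complexity :: "nat \<Rightarrow> qvec \<Rightarrow> nat" where
  "circuit_complexity n \<psi> = (LEAST l. \<exists>ls. length ls = l \<and> (\<forall>L\<in>set ls. valid_layer n L) \<and>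
      (\<forall>x\<in>cfg {0..<n}. apply_circuit n ls ket0 x = \<psi> x))"

definition robust_complexity :: "nat \<Rightarrow> real \<Rightarrow> qvec \<Rightarrow> nat" where
  "robust_complexity n \<delta> \<psi> = (LEAST l. \<exists>\<psi>'. unit_vec n \<psi>' \<and>
      trace_norm (cfg {0..<n}) (\<lambda>x y. proj \<psi>' x y - proj \<psi> x y) \<le> \<delta> \<and>
      circuit_complexity n \<psi>' = l)"

definition H2 :: "real \<Rightarrow> real" where
  "H2 p = - p * log 2 p - (1 - p) * log 2 (1 - p)"

end

theory Submission
  imports Defs
begin

text \<open>
  Suppose a circuit U of depth l with \<open>2\<^sup>l \<le> d\<close> prepares a state \<open>\<psi>'\<close> that is \<open>\<delta>\<close>-close to \<open>\<psi>\<close>.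
  The reflection \<open>U Z\<^sub>i U\<^sup>\<dagger>\<close> is supported on at most d qubits, and its expectation in \<open>\<psi>'\<close> is 1.
  Passing from \<open>\<psi>'\<close> to \<open>\<psi>\<close> costs at most \<open>\<delta>\<close>, and passing from \<open>\<psi>\<close> to the maximally mixed code
  state \<open>\<Gamma>\<close> costs at most \<open>\<epsilon>\<close> because only the reduced states on the support matter.  Hence measuring
  \<open>U\<^sup>\<dagger> \<Gamma> U\<close> in the computational basis gives a distribution p on bit strings in which every bit is 1
  with probability at most \<open>(\<epsilon> + \<delta>) / 2 < 1/2\<close>, while every string has probability at most \<open>2\<^sup>-\<^sup>k\<close>.
  So the entropy of p is at least k and at most \<open>n H\<^sub>2((\<epsilon> + \<delta>) / 2)\<close>.
\<close>

subsection \<open>Sums over configurations\<close>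

abbreviation reg :: "nat \<Rightarrow> config set" where
  "reg n \<equiv> cfg {0..<n}"

lemma finite_cfg [simp]: "finite S \<Longrightarrow> finite (cfg S)"
proof -
  assume "finite S"
  moreover have "cfg S \<subseteq> (\<lambda>T i. i \<in> T) ` Pow S"
  proof
    fix x assume "x \<in> cfg S"
    then have "x = (\<lambda>i. i \<in> {i. x i})" "{i. x i} \<in> Pow S"
      by (auto simp: cfg_def)
    then show "x \<in> (\<lambda>T i. i \<in> T) ` Pow S" by blast
  qed
  ultimately show ?thesis by (meson finite_Pow_iff finite_imageI finite_subset)
qed

lemma cfg_upd: "x \<in> cfg S \<Longrightarrow> a \<in> S \<Longrightarrow> x(a := r) \<in> cfg S"
  by (auto simp: cfg_def)

lemma cfg_upd_False: "x \<in> cfg S \<Longrightarrow> x(a := False) \<in> cfg S"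
  by (auto simp: cfg_def)

lemma cfg_mono: "S \<subseteq> T \<Longrightarrow> cfg S \<subseteq> cfg T"
  by (auto simp: cfg_def)

lemma cfg_eqI:
  assumes "x \<in> cfg S" "y \<in> cfg S" "\<And>i. i \<in> S \<Longrightarrow> x i = y i"
  shows "x = y"
  using assms by (force simp: cfg_def)

lemma zero_in_cfg [simp]: "(\<lambda>_. False) \<in> cfg S"
  by (simp add: cfg_def)

lemma sum_cfg_insert:
  fixes f :: "config \<Rightarrow> 'a::comm_monoid_add"
  assumes "finite S" "m \<notin> S"
  shows "(\<Sum>x\<in>cfg (insert m S). f x) = (\<Sum>x\<in>cfg S. f x + f (x(m := True)))"
proof -
  have cfg: "cfg (insert m S) = cfg S \<union> (\<lambda>x. x(m := True)) ` cfg S"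
  proof
    show "cfg (insert m S) \<subseteq> cfg S \<union> (\<lambda>x. x(m := True)) ` cfg S"
    proof
      fix x assume x: "x \<in> cfg (insert m S)"
      show "x \<in> cfg S \<union> (\<lambda>x. x(m := True)) ` cfg S"
      proof (cases "x m")
        case True
        then have "x = (x(m := False))(m := True)" by (simp add: fun_upd_idem)
        moreover have "x(m := False) \<in> cfg S" using x by (auto simp: cfg_def)
        ultimately show ?thesis by blast
      next
        case False
        then show ?thesis using x by (auto simp: cfg_def)
      qed
    qed
  qed (auto simp: cfg_def)
  have "cfg S \<inter> (\<lambda>x. x(m := True)) ` cfg S = {}"
  proof -
    have "x \<in> cfg S \<Longrightarrow> \<not> x m" for x using assms by (simp add: cfg_def)
    then show ?thesis by fastforce
  qed
  moreover have "inj_on (\<lambda>x. x(m := True)) (cfg S)"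
  proof (rule inj_onI)
    fix x y assume xy: "x \<in> cfg S" "y \<in> cfg S" "x(m := True) = y(m := True)"
    show "x = y"
    proof (rule cfg_eqI[OF xy(1,2)])
      fix i assume "i \<in> S"
      then show "x i = y i" using fun_cong[OF xy(3), of i] assms by (auto split: if_splits)
    qed
  qed
  ultimately show ?thesis
    unfolding cfg using assms by (simp add: sum.union_disjoint sum.reindex sum.distrib)
qed

text \<open>Restricting a configuration to \<open>S\<close> and to \<open>T - S\<close> is a
  bijection with inverse \<open>merge S\<close>. This is the tensor factorisation behind partial
  traces.\<close>

lemma sum_cfg_merge:
  fixes f :: "config \<Rightarrow> 'a::comm_monoid_add"
  assumes "finite T" "S \<subseteq> T"
  shows "(\<Sum>x\<in>cfg T. f x) = (\<Sum>x\<in>cfg S. \<Sum>z\<in>cfg (T - S). f (merge S x z))"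
proof -
  have "(\<Sum>x\<in>cfg T. f x) = (\<Sum>(x, z)\<in>cfg S \<times> cfg (T - S). f (merge S x z))"
    by (rule sum.reindex_bij_witness[where i = "\<lambda>(x, z). merge S x z"
          and j = "\<lambda>x. (\<lambda>i. i \<in> S \<and> x i, \<lambda>i. i \<notin> S \<and> x i)"])
      (use assms in \<open>auto simp: cfg_def merge_def fun_eq_iff\<close>)
  then show ?thesis by (simp add: sum.cartesian_product)
qed

lemma sum_UNIV_bool:
  fixes f :: "bool \<Rightarrow> 'a::comm_monoid_add"
  shows "(\<Sum>r\<in>UNIV. f r) = f False + f True"
  by (simp add: UNIV_bool add.commute)

lemma sum_delta_mult:
  fixes f :: "'b \<Rightarrow> 'a::comm_semiring_1"
  assumes "finite I" "x \<in> I"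
  shows "(\<Sum>y\<in>I. (if x = y then 1 else 0) * f y) = f x"
    and "(\<Sum>y\<in>I. (if y = x then 1 else 0) * f y) = f x"
  using assms by (simp_all add: if_distrib[where f = "\<lambda>t. t * _"] cong: if_cong)

subsection \<open>Gates\<close>

text \<open>Row \<open>x\<close> of a gate is supported on the four settings of bits
  \<open>a\<close> and \<open>b\<close> in \<open>x\<close>. No unitarity is assumed, so the formula
  also serves for conjugated and adjoint gates.\<close>

lemma gate_op_sum:
  assumes "x \<in> reg n" "a < n" "b < n" "a \<noteq> b"
  shows "(\<Sum>y\<in>reg n. gate_op (a, b, g) x y * f y)
       = (\<Sum>r\<in>UNIV. \<Sum>s\<in>UNIV. g (x a) (x b) r s * f (x(a := r, b := s)))"
proof -
  let ?h = "\<lambda>(r, s). x(a := r, b := s)"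
  have inj: "inj ?h"
    using assms(4) by (auto simp: inj_on_def fun_eq_iff split: if_splits)
  have sub: "range ?h \<subseteq> reg n"
    using assms by (auto simp: cfg_def)
  have out: "gate_op (a, b, g) x y = 0" if "y \<notin> range ?h" for y
  proof -
    have "\<not> (\<forall>i. i \<noteq> a \<and> i \<noteq> b \<longrightarrow> x i = y i)"
    proof
      assume "\<forall>i. i \<noteq> a \<and> i \<noteq> b \<longrightarrow> x i = y i"
      then have "y = ?h (y a, y b)" by (auto simp: fun_eq_iff)
      then show False using that by blast
    qed
    then show ?thesis by (auto simp: gate_op_def)
  qed
  have "(\<Sum>y\<in>reg n. gate_op (a, b, g) x y * f y) = (\<Sum>y\<in>range ?h. gate_op (a, b, g) x y * f y)"
    using sub out by (intro sum.mono_neutral_right) auto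
  also have "\<dots> = (\<Sum>rs\<in>UNIV. gate_op (a, b, g) x (?h rs) * f (?h rs))"
    by (subst sum.reindex[OF inj]) (simp add: comp_def)
  also have "\<dots> = (\<Sum>(r, s)\<in>UNIV \<times> UNIV. g (x a) (x b) r s * f (x(a := r, b := s)))"
    unfolding UNIV_Times_UNIV using assms(4) by (intro sum.cong) (auto simp: gate_op_def)
  finally show ?thesis by (simp add: sum.cartesian_product)
qed

lemma apply_gate:
  assumes "x \<in> reg n" "a < n" "b < n" "a \<noteq> b"
  shows "apply_op n (gate_op (a, b, g)) \<psi> x
       = (\<Sum>r\<in>UNIV. \<Sum>s\<in>UNIV. g (x a) (x b) r s * \<psi> (x(a := r, b := s)))"
  unfolding apply_op_def by (rule gate_op_sum[OF assms])

text \<open>\<open>unitary2\<close> gives orthonormal rows. For a finite square matrix a right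
  inverse is also a left inverse, which turns this into orthonormal columns.\<close>

lemma unitary2_columns:
  assumes "unitary2 g"
  shows "(\<Sum>r\<in>UNIV. \<Sum>s\<in>UNIV. cnj (g r s p q) * g r s p' q') = (if p = p' \<and> q = q' then 1 else 0)"
proof -
  define A :: "complex^(bool\<times>bool)^(bool\<times>bool)" where "A = (\<chi> i j. g (fst i) (snd i) (fst j) (snd j))"
  define B :: "complex^(bool\<times>bool)^(bool\<times>bool)" where "B = (\<chi> i j. cnj (g (fst j) (snd j) (fst i) (snd i)))"
  have "A ** B = mat 1"
    using assms
    by (auto simp: A_def B_def matrix_matrix_mult_def mat_def vec_eq_iff unitary2_def sum.cartesian_product
        UNIV_Times_UNIV[symmetric] case_prod_beta simp del: UNIV_Times_UNIV)
  then have "B ** A = mat 1" by (simp add: matrix_left_right_inverse)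
  then have "(B ** A) $ (p, q) $ (p', q') = mat 1 $ (p, q) $ (p', q')" by simp
  then show ?thesis
    by (simp add: A_def B_def matrix_matrix_mult_def mat_def sum.cartesian_product
        UNIV_Times_UNIV[symmetric] case_prod_beta del: UNIV_Times_UNIV)
qed

text \<open>The adjoint of a gate is the gate with the conjugate transposed matrix, so the sum over
  a column is again a four-term sum.\<close>

lemma gate_op_columns:
  assumes "u \<in> reg n" "v \<in> reg n" "a < n" "b < n" "a \<noteq> b" "unitary2 g"
  shows "(\<Sum>x\<in>reg n. cnj (gate_op (a, b, g) x u) * gate_op (a, b, g) x v) = (if u = v then 1 else 0)"
proof -
  define agree where "agree \<longleftrightarrow> (\<forall>i. i \<noteq> a \<and> i \<noteq> b \<longrightarrow> u i = v i)"
  have gate_uv: "gate_op (a, b, g) (u(a := r, b := s)) v = (if agree then g r s (v a) (v b) else 0)" for r s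
    using assms(5) by (auto simp: gate_op_def agree_def)
  have cnj: "cnj (gate_op (a, b, g) x u) = gate_op (a, b, \<lambda>p q r s. cnj (g r s p q)) u x" for x
    by (auto simp: gate_op_def)
  have "(\<Sum>x\<in>reg n. cnj (gate_op (a, b, g) x u) * gate_op (a, b, g) x v)
      = (\<Sum>r\<in>UNIV. \<Sum>s\<in>UNIV. cnj (g r s (u a) (u b)) * gate_op (a, b, g) (u(a := r, b := s)) v)"
    unfolding cnj by (rule gate_op_sum[OF assms(1,3,4,5)])
  also have "\<dots> = (if agree then (\<Sum>r\<in>UNIV. \<Sum>s\<in>UNIV. cnj (g r s (u a) (u b)) * g r s (v a) (v b)) else 0)"
    unfolding gate_uv by simp
  also have "\<dots> = (if u = v then 1 else 0)"
    unfolding unitary2_columns[OF assms(6)] by (auto simp: fun_eq_iff agree_def)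
  finally show ?thesis .
qed

lemma inner_q_apply_gate:
  assumes "a < n" "b < n" "a \<noteq> b" "unitary2 g"
  shows "inner_q n (apply_op n (gate_op (a, b, g)) \<phi>) (apply_op n (gate_op (a, b, g)) \<psi>) = inner_q n \<phi> \<psi>"
proof -
  let ?G = "gate_op (a, b, g)"
  have "inner_q n (apply_op n ?G \<phi>) (apply_op n ?G \<psi>)
      = (\<Sum>x\<in>reg n. \<Sum>u\<in>reg n. \<Sum>v\<in>reg n. cnj (\<phi> u) * \<psi> v * (cnj (?G x u) * ?G x v))"
    unfolding inner_q_def apply_op_def cnj_sum sum_product by (simp add: mult_ac)
  also have "\<dots> = (\<Sum>u\<in>reg n. \<Sum>v\<in>reg n. \<Sum>x\<in>reg n. cnj (\<phi> u) * \<psi> v * (cnj (?G x u) * ?G x v))"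
    by (subst sum.swap, rule sum.cong[OF refl], rule sum.swap)
  also have "\<dots> = (\<Sum>u\<in>reg n. \<Sum>v\<in>reg n. cnj (\<phi> u) * \<psi> v * (if u = v then 1 else 0))"
    unfolding sum_distrib_left[symmetric]
    by (intro sum.cong refl arg_cong2[where f = "(*)"] gate_op_columns assms)
  also have "\<dots> = inner_q n \<phi> \<psi>"
    unfolding inner_q_def by (intro sum.cong) (simp_all add: if_distrib cong: if_cong)
  finally show ?thesis .
qed

subsection \<open>Light cones\<close>

text \<open>This is \<open>G M\<close> times the adjoint of \<open>G\<close>, the step by which an
  observable passes through a gate.\<close>

definition conj_op :: "nat \<Rightarrow> qop \<Rightarrow> qop \<Rightarrow> qop" where
  "conj_op n G M = (\<lambda>x y. \<Sum>u\<in>reg n. \<Sum>v\<in>reg n. G x u * M u v * cnj (G y v))"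

lemma conj_gate:
  assumes "x \<in> reg n" "y \<in> reg n" "a < n" "b < n" "a \<noteq> b"
  shows "conj_op n (gate_op (a, b, g)) M x y =
    (\<Sum>r\<in>UNIV. \<Sum>s\<in>UNIV. \<Sum>r'\<in>UNIV. \<Sum>s'\<in>UNIV. g (x a) (x b) r s * cnj (g (y a) (y b) r' s') *
       M (x(a := r, b := s)) (y(a := r', b := s')))"
proof -
  let ?G = "gate_op (a, b, g)"
  have cnj: "cnj (?G y v) = gate_op (a, b, \<lambda>p q r s. cnj (g p q r s)) y v" for v
    by (auto simp: gate_op_def)
  have "conj_op n ?G M x y = (\<Sum>u\<in>reg n. ?G x u * (\<Sum>v\<in>reg n. cnj (?G y v) * M u v))"
    by (simp add: conj_op_def sum_distrib_left mult_ac)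
  also have "\<dots> = (\<Sum>u\<in>reg n. ?G x u * (\<Sum>r'\<in>UNIV. \<Sum>s'\<in>UNIV. cnj (g (y a) (y b) r' s') * M u (y(a := r', b := s'))))"
    unfolding cnj gate_op_sum[OF assms(2-5)] ..
  also have "\<dots> = (\<Sum>r\<in>UNIV. \<Sum>s\<in>UNIV. g (x a) (x b) r s *
     (\<Sum>r'\<in>UNIV. \<Sum>s'\<in>UNIV. cnj (g (y a) (y b) r' s') * M (x(a := r, b := s)) (y(a := r', b := s'))))"
    by (rule gate_op_sum[OF assms(1,3-5)])
  finally show ?thesis by (simp add: sum_distrib_left mult_ac)
qed

text \<open>M is the identity on qubit j tensored with an operator on the other qubits.\<close>
definition trivial_at :: "nat \<Rightarrow> nat \<Rightarrow> qop \<Rightarrow> bool" where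
  "trivial_at n j M \<longleftrightarrow> (\<forall>x\<in>reg n. \<forall>y\<in>reg n.
     M x y = (if x j = y j then M (x(j := False)) (y(j := False)) else 0))"

text \<open>The gate leaves bit \<open>j\<close> alone, and resetting \<open>j\<close> commutes with
  overwriting \<open>a\<close> and \<open>b\<close>.\<close>

lemma trivial_at_conj_gate:
  assumes M: "trivial_at n j M" and ab: "a < n" "b < n" "a \<noteq> b" and j: "j \<noteq> a" "j \<noteq> b"
  shows "trivial_at n j (conj_op n (gate_op (a, b, g)) M)"
  unfolding trivial_at_def
proof (intro ballI)
  fix x y assume xy: "x \<in> reg n" "y \<in> reg n"
  have *: "M (x(a := r, b := s)) (y(a := r', b := s')) =
     (if x j = y j then M (x(j := False, a := r, b := s)) (y(j := False, a := r', b := s')) else 0)" for r s r' s'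
  proof -
    have "x(a := r, b := s) \<in> reg n" "y(a := r', b := s') \<in> reg n"
      using xy ab by (auto intro!: cfg_upd)
    moreover have "z(a := r, b := s, j := False) = z(j := False, a := r, b := s)" for z :: config and r s
      using j by (simp add: fun_upd_twist)
    ultimately show ?thesis
      using M j by (simp add: trivial_at_def)
  qed
  show "conj_op n (gate_op (a, b, g)) M x y = (if x j = y j
       then conj_op n (gate_op (a, b, g)) M (x(j := False)) (y(j := False)) else 0)"
    unfolding conj_gate[OF xy ab]
      conj_gate[OF cfg_upd_False[OF xy(1)] cfg_upd_False[OF xy(2)] ab] *
    using j by simp
qed

text \<open>An operator that is the identity on both gate qubits commutes with the gate, so the gate
  cancels against its adjoint.\<close>

lemma conj_gate_trivial:
  assumes M: "trivial_at n a M" "trivial_at n b M" and ab: "a < n" "b < n" "a \<noteq> b"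
    and g: "unitary2 g" and xy: "x \<in> reg n" "y \<in> reg n"
  shows "conj_op n (gate_op (a, b, g)) M x y = M x y"
proof -
  \<comment> \<open>All entries of \<open>M\<close> that survive after overwriting bits
    \<open>a\<close> and \<open>b\<close> share this value, so it factors out and row orthonormality
    of \<open>g\<close> remains.\<close>
  define K where "K = M (x(a := False, b := False)) (y(a := False, b := False))"
  have M2: "M u v = (if u a = v a \<and> u b = v b then M (u(a := False, b := False)) (v(a := False, b := False)) else 0)"
    if "u \<in> reg n" "v \<in> reg n" for u v
  proof -
    have "M u v = (if u a = v a then M (u(a := False)) (v(a := False)) else 0)"
      using M(1) that by (simp add: trivial_at_def)
    moreover have "M (u(a := False)) (v(a := False)) = (if (u(a := False)) b = (v(a := False)) b then
         M (u(a := False, b := False)) (v(a := False, b := False)) else 0)"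
      using M(2) that by (auto simp: trivial_at_def cfg_upd_False)
    ultimately show ?thesis using ab by simp
  qed
  have "M (x(a := r, b := s)) (y(a := r', b := s')) = (if r = r' \<and> s = s' then K else 0)" for r s r' s'
  proof -
    have "x(a := r, b := s) \<in> reg n" "y(a := r', b := s') \<in> reg n"
      using xy ab by (auto intro!: cfg_upd)
    moreover have "z(a := r, b := s, a := False, b := False) = z(a := False, b := False)" for z :: config and r s
      using ab by auto
    ultimately show ?thesis
      using ab by (simp add: K_def M2[of "x(a := r, b := s)" "y(a := r', b := s')"])
  qed
  note M3 = this
  have delta: "(\<Sum>r'\<in>UNIV. \<Sum>s'\<in>UNIV. c * h r' s' * (if r = r' \<and> s = s' then L else 0)) = c * h r s * L"
    for r s and h :: "bool \<Rightarrow> bool \<Rightarrow> complex" and c L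
    by (cases r; cases s) (simp_all add: sum_UNIV_bool)
  have "conj_op n (gate_op (a, b, g)) M x y =
    (\<Sum>r\<in>UNIV. \<Sum>s\<in>UNIV. g (x a) (x b) r s * cnj (g (y a) (y b) r s)) * K"
    unfolding conj_gate[OF xy ab]
    by (simp only: M3 delta sum_distrib_right)
  also have "\<dots> = (if x a = y a \<and> x b = y b then 1 else 0) * K"
    using g by (simp add: unitary2_def)
  also have "\<dots> = M x y"
    using M2[OF xy] by (simp add: K_def)
  finally show ?thesis .
qed

lemma trivial_at_cong:
  assumes "\<And>x y. x \<in> reg n \<Longrightarrow> y \<in> reg n \<Longrightarrow> M x y = M' x y"
  shows "trivial_at n j M \<longleftrightarrow> trivial_at n j M'"
  using assms by (simp add: trivial_at_def cfg_upd_False)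

lemma valid_layer_Cons:
  assumes "valid_layer n (G # gs)"
  shows "valid_layer n gs" and "\<And>H. H \<in> set gs \<Longrightarrow> gate_qubits G \<inter> gate_qubits H = {}"
    and "fst G < n" "fst (snd G) < n" "fst G \<noteq> fst (snd G)" "unitary2 (snd (snd G))"
proof -
  show "valid_layer n gs"
    unfolding valid_layer_def
  proof (intro conjI ballI allI impI)
    fix i j assume "i < length gs" "j < length gs" "i \<noteq> j"
    then have "gate_qubits ((G # gs) ! Suc i) \<inter> gate_qubits ((G # gs) ! Suc j) = {}"
      using assms unfolding valid_layer_def by (metis Suc_inject Suc_mono length_Cons)
    then show "gate_qubits (gs ! i) \<inter> gate_qubits (gs ! j) = {}" by simp
  qed (use assms in \<open>auto simp: valid_layer_def\<close>)
  show "gate_qubits G \<inter> gate_qubits H = {}" if H: "H \<in> set gs" for H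
  proof -
    obtain i where "i < length gs" "H = gs ! i" using H by (metis in_set_conv_nth)
    moreover have "\<forall>i<length (G # gs). \<forall>j<length (G # gs).
        i \<noteq> j \<longrightarrow> gate_qubits ((G # gs) ! i) \<inter> gate_qubits ((G # gs) ! j) = {}"
      using assms unfolding valid_layer_def by blast
    ultimately have "gate_qubits ((G # gs) ! 0) \<inter> gate_qubits ((G # gs) ! Suc i) = {}"
      by (metis Suc_mono length_Cons nat.distinct(1) zero_less_Suc)
    then show ?thesis using \<open>H = gs ! i\<close> by simp
  qed
qed (use assms in \<open>auto simp: valid_layer_def\<close>)

lemma layer_light_cone:
  assumes "valid_layer n gs" "S \<subseteq> {0..<n}" "\<And>j. j < n \<Longrightarrow> j \<notin> S \<Longrightarrow> trivial_at n j M"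
  shows "\<exists>S'. S' \<subseteq> {0..<n} \<and> S' \<subseteq> S \<union> \<Union>(gate_qubits ` set gs) \<and>
     card S' \<le> card S + card (S \<inter> \<Union>(gate_qubits ` set gs)) \<and> S \<subseteq> S' \<and>
     (\<forall>j<n. j \<notin> S' \<longrightarrow> trivial_at n j (foldr (\<lambda>G. conj_op n (gate_op G)) gs M))"
  using assms(1)
proof (induction gs)
  case Nil
  then show ?case using assms by auto
next
  case (Cons G gs)
  obtain a b g where G: "G = (a, b, g)" by (cases G)
  have ab: "a < n" "b < n" "a \<noteq> b" "unitary2 g" and valid: "valid_layer n gs"
    and disj: "\<And>H. H \<in> set gs \<Longrightarrow> {a, b} \<inter> gate_qubits H = {}"
    using valid_layer_Cons[OF Cons.prems] by (auto simp: G gate_qubits_def)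
  let ?U = "\<Union>(gate_qubits ` set gs)"
  let ?M = "foldr (\<lambda>G. conj_op n (gate_op G)) gs M"
  have U: "\<Union>(gate_qubits ` set (G # gs)) = {a, b} \<union> ?U" by (auto simp: G gate_qubits_def)
  have abU: "{a, b} \<inter> ?U = {}" using disj by auto
  have finS: "finite S" using assms(2) finite_subset by blast
  obtain S' where S': "S' \<subseteq> {0..<n}" "S' \<subseteq> S \<union> ?U" "card S' \<le> card S + card (S \<inter> ?U)" "S \<subseteq> S'"
    and triv: "\<And>j. j < n \<Longrightarrow> j \<notin> S' \<Longrightarrow> trivial_at n j ?M"
    using Cons.IH[OF valid] by blast
  have finS': "finite S'" using S'(1) finite_subset by blast
  show ?case
  proof (cases "{a, b} \<inter> S = {}")
    case True
    \<comment> \<open>The gates of a layer are disjoint, so qubits that entered \<open>S'\<close>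
      through other gates cannot be \<open>a\<close> or \<open>b\<close>.\<close>
    then have notin: "a \<notin> S'" "b \<notin> S'" using S'(2) abU by auto
    have "trivial_at n j (conj_op n (gate_op G) ?M)" if "j < n" "j \<notin> S'" for j
      using triv[OF that] conj_gate_trivial[OF triv[OF ab(1) notin(1)] triv[OF ab(2) notin(2)] ab]
      by (subst trivial_at_cong[where M' = ?M]) (auto simp: G)
    moreover have "S \<inter> ({a, b} \<union> ?U) = S \<inter> ?U" using True by auto
    ultimately show ?thesis
      unfolding U using S' by (intro exI[of _ S']) auto
  next
    case False
    have "trivial_at n j (conj_op n (gate_op G) ?M)" if "j < n" "j \<notin> S' \<union> {a, b}" for j
      using trivial_at_conj_gate[OF triv[OF that(1)] ab(1-3)] that by (simp add: G)
    moreover have "card (S' \<union> {a, b}) \<le> card S + card (S \<inter> ({a, b} \<union> ?U))"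
    proof -
      \<comment> \<open>Only \<open>c'\<close> can be new. The qubit \<open>c\<close> lies outside
        all other gates, so it raises the second cardinality by one and pays for
        \<open>c'\<close>.\<close>
      obtain c c' where c: "c \<in> S" "{a, b} = {c, c'}" using False by auto
      then have "S' \<union> {a, b} = insert c' S'" using S'(4) by auto
      then have "card (S' \<union> {a, b}) \<le> card S' + 1" using finS' by (simp add: card_insert_if)
      moreover have "card (insert c (S \<inter> ?U)) \<le> card (S \<inter> ({a, b} \<union> ?U))"
        using c finS by (intro card_mono) auto
      moreover have "card (insert c (S \<inter> ?U)) = card (S \<inter> ?U) + 1"
        using c abU finS by (subst card_insert_disjoint) auto
      ultimately show ?thesis using S'(3) by linarith
    qed
    ultimately show ?thesis
      unfolding U using S' ab by (intro exI[of _ "S' \<union> {a, b}"]) auto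
  qed
qed

section \<open>Observables evolved through a circuit\<close>

definition valid_gate :: "nat \<Rightarrow> gate \<Rightarrow> bool" where
  "valid_gate n G \<longleftrightarrow> fst G < n \<and> fst (snd G) < n \<and> fst G \<noteq> fst (snd G) \<and> unitary2 (snd (snd G))"

lemma valid_gate_iff:
  "valid_gate n (a, b, g) \<longleftrightarrow> a < n \<and> b < n \<and> a \<noteq> b \<and> unitary2 g"
  by (simp add: valid_gate_def)

lemma valid_layer_gates: "valid_layer n L \<Longrightarrow> G \<in> set L \<Longrightarrow> valid_gate n G"
  by (simp add: valid_layer_def valid_gate_def)

lemma apply_layer_Nil [simp]: "apply_layer n [] \<psi> = \<psi>"
  and apply_layer_Cons [simp]: "apply_layer n (G # gs) \<psi> = apply_op n (gate_op G) (apply_layer n gs \<psi>)"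
  by (simp_all add: apply_layer_def)

text \<open>Norms and overlaps do not depend on the grouping into layers, so they can be studied on
  the flat gate list; layers matter only for the light cone.\<close>

lemma apply_circuit_concat: "apply_circuit n ls \<psi> = apply_layer n (concat ls) \<psi>"
  by (induction ls) (simp_all add: apply_circuit_def apply_layer_def)

definition ket :: "config \<Rightarrow> qvec" where
  "ket x = (\<lambda>y. if y = x then 1 else 0)"

lemma ket0_eq: "ket0 = ket (\<lambda>_. False)"
  by (simp add: ket0_def ket_def)

text \<open>The Heisenberg-evolved observable \<open>U diag(w) U\<^sup>\<dagger>\<close>, where U is the unitary of the gate list.\<close>
definition obs :: "nat \<Rightarrow> gate list \<Rightarrow> (config \<Rightarrow> complex) \<Rightarrow> qop" where
  "obs n gs w = (\<lambda>y z. \<Sum>x\<in>reg n. w x * proj (apply_layer n gs (ket x)) y z)"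

lemma obs_Nil:
  assumes "y \<in> reg n" "z \<in> reg n"
  shows "obs n [] w y z = (if y = z then w y else 0)"
proof -
  have "obs n [] w y z = (\<Sum>x\<in>reg n. (if y = x then 1 else 0) * (if z = x then w x else 0))"
    unfolding obs_def by (intro sum.cong) (auto simp: proj_def ket_def)
  also have "\<dots> = (if y = z then w y else 0)"
    using assms by (subst sum_delta_mult) auto
  finally show ?thesis .
qed

lemma obs_Cons: "obs n (G # gs) w = conj_op n (gate_op G) (obs n gs w)"
proof (intro ext)
  fix y z
  let ?G = "gate_op G" and ?\<phi> = "\<lambda>x. apply_layer n gs (ket x)"
  have "obs n (G # gs) w y z = (\<Sum>x\<in>reg n. \<Sum>u\<in>reg n. \<Sum>v\<in>reg n.
      w x * (?G y u * ?\<phi> x u * (cnj (?G z v) * cnj (?\<phi> x v))))"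
    unfolding obs_def proj_def apply_layer_Cons apply_op_def cnj_sum sum_product by (simp add: sum_distrib_left)
  also have "\<dots> = (\<Sum>u\<in>reg n. \<Sum>v\<in>reg n. \<Sum>x\<in>reg n.
      w x * (?G y u * ?\<phi> x u * (cnj (?G z v) * cnj (?\<phi> x v))))"
    by (subst sum.swap, rule sum.cong[OF refl], rule sum.swap)
  also have "\<dots> = conj_op n ?G (obs n gs w) y z"
    by (simp add: conj_op_def obs_def proj_def sum_distrib_left sum_distrib_right mult_ac)
  finally show "obs n (G # gs) w y z = conj_op n ?G (obs n gs w) y z" .
qed

lemma obs_append: "obs n (gs @ gs') w = foldr (\<lambda>G. conj_op n (gate_op G)) gs (obs n gs' w)"
  by (induction gs) (simp_all add: obs_Cons)

text \<open>The eigenvalue of Pauli Z on qubit \<open>i\<close>; products of these are the parity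
  characters used for phases.\<close>

definition zsign :: "nat \<Rightarrow> config \<Rightarrow> real" where
  "zsign i x = (if x i then -1 else 1)"

lemma trivial_at_diag:
  assumes "\<And>x. w (x(j := False)) = w x"
  shows "trivial_at n j (\<lambda>x y. if x = y then w x else 0)"
proof -
  have "x = y \<longleftrightarrow> x j = y j \<and> x(j := False) = y(j := False)" for x y :: config
    by (auto simp: fun_eq_iff)
  note eq_iff = this
  show ?thesis
    unfolding trivial_at_def
  proof (intro ballI)
    fix x y :: config
    show "(if x = y then w x else 0) = (if x j = y j
       then (if x(j := False) = y(j := False) then w (x(j := False)) else 0) else 0)"
      unfolding assms using eq_iff[of x y] by (cases "x = y") auto
  qed
qed

text \<open>The support starts as \<open>{i}\<close>, and each layer at most doubles it because the
  intersection term in \<open>layer_light_cone\<close> is at most \<open>card S\<close>.\<close>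

lemma circuit_light_cone:
  assumes "\<forall>L\<in>set ls. valid_layer n L" "i < n"
  shows "\<exists>S\<subseteq>{0..<n}. card S \<le> 2 ^ length ls \<and>
     (\<forall>j<n. j \<notin> S \<longrightarrow> trivial_at n j (obs n (concat ls) (\<lambda>x. of_real (zsign i x))))"
  using assms(1)
proof (induction ls)
  case Nil
  have "trivial_at n j (obs n [] (\<lambda>x. of_real (zsign i x)))" if "j \<noteq> i" for j
    by (subst trivial_at_cong[OF obs_Nil], assumption+, rule trivial_at_diag)
      (use that in \<open>simp add: zsign_def\<close>)
  then show ?case using assms(2) by (intro exI[of _ "{i}"]) auto
next
  case (Cons L ls)
  then obtain S where S: "S \<subseteq> {0..<n}" "card S \<le> 2 ^ length ls"
    "\<And>j. j < n \<Longrightarrow> j \<notin> S \<Longrightarrow> trivial_at n j (obs n (concat ls) (\<lambda>x. of_real (zsign i x)))"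
    by auto
  have "valid_layer n L" using Cons.prems by simp
  from layer_light_cone[OF this S(1,3)]
  obtain S' where S': "S' \<subseteq> {0..<n}" "card S' \<le> card S + card (S \<inter> \<Union>(gate_qubits ` set L))"
    "\<forall>j<n. j \<notin> S' \<longrightarrow> trivial_at n j (obs n (concat (L # ls)) (\<lambda>x. of_real (zsign i x)))"
    by (auto simp: obs_append)
  have "card (S \<inter> \<Union>(gate_qubits ` set L)) \<le> card S"
    using S(1) by (intro card_mono) (auto intro: finite_subset)
  then have "card S' \<le> 2 ^ length (L # ls)" using S'(2) S(2) by simp
  then show ?case using S' by blast
qed

lemma inner_q_apply_layer:
  assumes "\<forall>G\<in>set gs. valid_gate n G"
  shows "inner_q n (apply_layer n gs \<phi>) (apply_layer n gs \<psi>) = inner_q n \<phi> \<psi>"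
  using assms
proof (induction gs)
  case (Cons G gs)
  then show ?case
    by (cases G) (simp add: valid_gate_iff inner_q_apply_gate)
qed simp

lemma inner_q_ket:
  assumes "x \<in> reg n" "y \<in> reg n"
  shows "inner_q n (ket x) (ket y) = (if x = y then 1 else 0)"
proof -
  have "inner_q n (ket x) (ket y) = (\<Sum>z\<in>reg n. (if z = x then 1 else 0) * (if z = y then 1 else 0))"
    unfolding inner_q_def by (intro sum.cong) (auto simp: ket_def)
  then show ?thesis using assms by (simp add: sum_delta_mult)
qed

text \<open>The identity is trivial at every qubit, so every gate conjugation fixes it. This is
  completeness of the evolved basis.\<close>

lemma obs_one:
  assumes "\<forall>G\<in>set gs. valid_gate n G" "y \<in> reg n" "z \<in> reg n"
  shows "obs n gs (\<lambda>_. 1) y z = (if y = z then 1 else 0)"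
  using assms
proof (induction gs arbitrary: y z)
  case Nil
  then show ?case by (simp add: obs_Nil)
next
  case (Cons G gs)
  obtain a b g where G: "G = (a, b, g)" by (cases G)
  have triv: "trivial_at n j (obs n gs (\<lambda>_. 1))" for j
    using Cons by (subst trivial_at_cong[OF Cons.IH]) (auto intro!: trivial_at_diag)
  show ?case
    using Cons.prems Cons.IH[OF _ Cons.prems(2,3)] conj_gate_trivial[OF triv triv]
    by (simp add: obs_Cons G valid_gate_iff)
qed

text \<open>The evolved basis is orthonormal, so multiplying by the adjoint replaces
  \<open>w\<close> by its squared modulus 1 and leaves
  \<open>obs n gs (\<lambda>_. 1)\<close>.\<close>

lemma unitary_on_obs:
  assumes gs: "\<forall>G\<in>set gs. valid_gate n G" and w: "\<And>x. w x * cnj (w x) = 1"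
  shows "unitary_on (reg n) (obs n gs w)"
  unfolding unitary_on_def
proof (intro ballI)
  fix y y' assume y: "y \<in> reg n" "y' \<in> reg n"
  define \<phi> where "\<phi> x = apply_layer n gs (ket x)" for x
  have orth: "(\<Sum>z\<in>reg n. cnj (\<phi> x z) * \<phi> x' z) = (if x = x' then 1 else 0)"
    if "x \<in> reg n" "x' \<in> reg n" for x x'
    using inner_q_apply_layer[OF gs, of "ket x" "ket x'"] inner_q_ket[OF that]
    by (simp add: \<phi>_def inner_q_def)
  have "(\<Sum>z\<in>reg n. obs n gs w y z * cnj (obs n gs w y' z)) =
    (\<Sum>z\<in>reg n. \<Sum>x\<in>reg n. \<Sum>x'\<in>reg n. w x * cnj (w x') * \<phi> x y * cnj (\<phi> x' y') * (cnj (\<phi> x z) * \<phi> x' z))"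
    unfolding obs_def proj_def \<phi>_def[symmetric] cnj_sum sum_product by (simp add: mult_ac)
  also have "\<dots> = (\<Sum>x\<in>reg n. \<Sum>x'\<in>reg n. \<Sum>z\<in>reg n. w x * cnj (w x') * \<phi> x y * cnj (\<phi> x' y') * (cnj (\<phi> x z) * \<phi> x' z))"
    by (subst sum.swap, rule sum.cong[OF refl], rule sum.swap)
  also have "\<dots> = (\<Sum>x\<in>reg n. \<Sum>x'\<in>reg n. w x * cnj (w x') * \<phi> x y * cnj (\<phi> x' y') * (if x = x' then 1 else 0))"
    unfolding sum_distrib_left[symmetric]
    by (intro sum.cong refl arg_cong2[where f = "(*)"] orth)
  also have "\<dots> = (\<Sum>x\<in>reg n. w x * cnj (w x) * (\<phi> x y * cnj (\<phi> x y')))"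
    by (intro sum.cong) (simp_all add: if_distrib mult_ac cong: if_cong)
  also have "\<dots> = obs n gs (\<lambda>_. 1) y y'"
    by (simp add: w obs_def proj_def \<phi>_def)
  finally show "(\<Sum>z\<in>reg n. obs n gs w y z * cnj (obs n gs w y' z)) = (if y = y' then 1 else 0)"
    using obs_one[OF gs y] by simp
qed

text \<open>The expectation of the observable is the mean of \<open>w\<close> under the Born
  probabilities in the evolved basis.\<close>

lemma trace_obs_proj:
  "(\<Sum>y\<in>reg n. \<Sum>z\<in>reg n. obs n gs w y z * proj \<beta> z y) =
   (\<Sum>x\<in>reg n. w x * of_real ((cmod (inner_q n (apply_layer n gs (ket x)) \<beta>))\<^sup>2))"
proof -
  define \<phi> where "\<phi> x = apply_layer n gs (ket x)" for x
  have "(\<Sum>y\<in>reg n. \<Sum>z\<in>reg n. obs n gs w y z * proj \<beta> z y) =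
    (\<Sum>y\<in>reg n. \<Sum>z\<in>reg n. \<Sum>x\<in>reg n. w x * (cnj (\<phi> x z) * \<beta> z * cnj (cnj (\<phi> x y) * \<beta> y)))"
    unfolding obs_def proj_def \<phi>_def[symmetric] sum_distrib_right by (simp add: mult_ac)
  also have "\<dots> = (\<Sum>y\<in>reg n. \<Sum>x\<in>reg n. \<Sum>z\<in>reg n. w x * (cnj (\<phi> x z) * \<beta> z * cnj (cnj (\<phi> x y) * \<beta> y)))"
    by (rule sum.cong[OF refl], rule sum.swap)
  also have "\<dots> = (\<Sum>x\<in>reg n. \<Sum>y\<in>reg n. \<Sum>z\<in>reg n. w x * (cnj (\<phi> x z) * \<beta> z * cnj (cnj (\<phi> x y) * \<beta> y)))"
    by (rule sum.swap)
  also have "\<dots> = (\<Sum>x\<in>reg n. w x * (inner_q n (\<phi> x) \<beta> * cnj (inner_q n (\<phi> x) \<beta>)))"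
  proof (rule sum.cong[OF refl])
    fix x
    have "(\<Sum>y\<in>reg n. \<Sum>z\<in>reg n. w x * (cnj (\<phi> x z) * \<beta> z * cnj (cnj (\<phi> x y) * \<beta> y)))
       = w x * (\<Sum>y\<in>reg n. inner_q n (\<phi> x) \<beta> * cnj (cnj (\<phi> x y) * \<beta> y))"
      unfolding inner_q_def sum_distrib_left sum_distrib_right by simp
    then show "(\<Sum>y\<in>reg n. \<Sum>z\<in>reg n. w x * (cnj (\<phi> x z) * \<beta> z * cnj (cnj (\<phi> x y) * \<beta> y)))
       = w x * (inner_q n (\<phi> x) \<beta> * cnj (inner_q n (\<phi> x) \<beta>))"
      by (simp only: inner_q_def cnj_sum sum_distrib_left)
  qed
  finally show ?thesis unfolding \<phi>_def complex_norm_square .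
qed

subsection \<open>Reduction to a subsystem\<close>

lemma trivial_at_set:
  assumes "finite T" "\<And>j. j \<in> T \<Longrightarrow> trivial_at n j M" "x \<in> reg n" "y \<in> reg n"
  shows "M x y = (if \<forall>j\<in>T. x j = y j then M (\<lambda>i. i \<notin> T \<and> x i) (\<lambda>i. i \<notin> T \<and> y i) else 0)"
  using assms
proof (induction T arbitrary: x y rule: finite_induct)
  case (insert t T)
  have upd: "(\<lambda>i. i \<notin> T \<and> (z(t := False)) i) = (\<lambda>i. i \<notin> insert t T \<and> z i)" for z :: config
    by auto
  have agree: "(\<forall>j\<in>T. (x(t := False)) j = (y(t := False)) j) \<longleftrightarrow> (\<forall>j\<in>T. x j = y j)"
    using insert.hyps(2) by auto
  have "M x y = (if x t = y t then M (x(t := False)) (y(t := False)) else 0)"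
    using insert.prems by (simp add: trivial_at_def)
  moreover have "M (x(t := False)) (y(t := False)) =
     (if \<forall>j\<in>T. x j = y j then M (\<lambda>i. i \<notin> insert t T \<and> x i) (\<lambda>i. i \<notin> insert t T \<and> y i) else 0)"
    by (subst insert.IH) (use insert.prems in \<open>simp_all add: cfg_upd_False upd agree del: fun_upd_apply\<close>)
  ultimately show ?case by simp
qed simp

text \<open>Such an \<open>M\<close> is an operator on \<open>S\<close> tensored with the identity,
  and its factor on \<open>S\<close> is read off at configurations that are False outside
  \<open>S\<close>.\<close>

lemma trace_reduced:
  assumes S: "S \<subseteq> {0..<n}" and M: "\<And>j. j < n \<Longrightarrow> j \<notin> S \<Longrightarrow> trivial_at n j M"
  shows "(\<Sum>y\<in>reg n. \<Sum>z\<in>reg n. M y z * \<rho> z y) = (\<Sum>x\<in>cfg S. \<Sum>y\<in>cfg S. M x y * ptrace n S \<rho> y x)"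
proof -
  let ?T = "{0..<n} - S"
  have M': "M (merge S x z) (merge S y z') = (if z' = z then 1 else 0) * M x y"
    if "x \<in> cfg S" "y \<in> cfg S" "z \<in> cfg ?T" "z' \<in> cfg ?T" for x y z z'
  proof -
    have reg: "merge S x z \<in> reg n" "merge S y z' \<in> reg n"
      using that S by (auto simp: cfg_def merge_def)
    have "(\<lambda>i. i \<notin> ?T \<and> merge S x z i) = x" "(\<lambda>i. i \<notin> ?T \<and> merge S y z' i) = y"
      using that S by (auto simp: cfg_def merge_def fun_eq_iff)
    note off = this
    have agree: "(\<forall>j\<in>?T. merge S x z j = merge S y z' j) \<longleftrightarrow> z' = z"
      using cfg_eqI[OF that(3,4)] by (auto simp: merge_def)
    have "M (merge S x z) (merge S y z') = (if z' = z then M x y else 0)"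
      by (subst trivial_at_set[of ?T n M, OF _ M reg]) (simp_all only: off agree, simp_all)
    then show ?thesis by simp
  qed
  have "(\<Sum>y\<in>reg n. \<Sum>z\<in>reg n. M y z * \<rho> z y) =
    (\<Sum>x\<in>cfg S. \<Sum>u\<in>cfg ?T. \<Sum>y\<in>cfg S. \<Sum>v\<in>cfg ?T.
       M (merge S x u) (merge S y v) * \<rho> (merge S y v) (merge S x u))"
    using S by (simp add: sum_cfg_merge[of "{0..<n}" S])
  also have "\<dots> = (\<Sum>x\<in>cfg S. \<Sum>u\<in>cfg ?T. \<Sum>y\<in>cfg S. \<Sum>v\<in>cfg ?T.
       (if v = u then 1 else 0) * (M x y * \<rho> (merge S y v) (merge S x u)))"
    by (intro sum.cong refl) (simp add: M')
  also have "\<dots> = (\<Sum>x\<in>cfg S. \<Sum>u\<in>cfg ?T. \<Sum>y\<in>cfg S. M x y * \<rho> (merge S y u) (merge S x u))"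
    by (intro sum.cong refl sum_delta_mult) auto
  also have "\<dots> = (\<Sum>x\<in>cfg S. \<Sum>y\<in>cfg S. \<Sum>u\<in>cfg ?T. M x y * \<rho> (merge S y u) (merge S x u))"
    by (rule sum.cong[OF refl], rule sum.swap)
  finally show ?thesis by (simp add: ptrace_def sum_distrib_left)
qed

text \<open>A row indexed by \<open>cfg S\<close> vanishes at every column with a bit set outside
  \<open>S\<close>, so restricting the sum to \<open>cfg S\<close> loses nothing.\<close>

lemma unitary_on_reduced:
  assumes S: "S \<subseteq> {0..<n}" and M: "\<And>j. j < n \<Longrightarrow> j \<notin> S \<Longrightarrow> trivial_at n j M"
    and U: "unitary_on (reg n) M"
  shows "unitary_on (cfg S) M"
  unfolding unitary_on_def
proof (intro ballI)
  fix x y assume xy: "x \<in> cfg S" "y \<in> cfg S"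
  have sub: "cfg S \<subseteq> reg n" by (rule cfg_mono[OF S])
  have "M x z = 0" if z: "z \<in> reg n - cfg S" for z
  proof -
    obtain j where "j \<notin> S" "z j" using z by (auto simp: cfg_def)
    moreover have "j < n" using z \<open>z j\<close> by (force simp: cfg_def)
    moreover have "\<not> x j" using xy \<open>j \<notin> S\<close> by (simp add: cfg_def)
    ultimately show ?thesis
      using M[of j] z xy(1) sub by (auto simp: trivial_at_def)
  qed
  then have "(\<Sum>z\<in>cfg S. M x z * cnj (M y z)) = (\<Sum>z\<in>reg n. M x z * cnj (M y z))"
    using sub by (intro sum.mono_neutral_left) auto
  then show "(\<Sum>z\<in>cfg S. M x z * cnj (M y z)) = (if x = y then 1 else 0)"
    using U subsetD[OF sub xy(1)] subsetD[OF sub xy(2)] by (simp add: unitary_on_def)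
qed

subsection \<open>Trace norm\<close>

lemma unitary_on_entry_le:
  assumes "finite I" "unitary_on I U" "x \<in> I" "y \<in> I"
  shows "cmod (U x y) \<le> 1"
proof -
  have "(\<Sum>z\<in>I. of_real ((cmod (U x z))\<^sup>2)) = (1::complex)"
    using assms unfolding complex_norm_square by (simp add: unitary_on_def)
  then have "(\<Sum>z\<in>I. (cmod (U x z))\<^sup>2) = 1"
    by (metis of_real_eq_1_iff of_real_sum)
  moreover have "(cmod (U x y))\<^sup>2 \<le> (\<Sum>z\<in>I. (cmod (U x z))\<^sup>2)"
    using assms by (intro member_le_sum) auto
  ultimately have "(cmod (U x y))\<^sup>2 \<le> 1\<^sup>2" by simp
  then show ?thesis by (rule power2_le_imp_le) simp
qed

text \<open>A crude bound, independent of \<open>U\<close>; it makes the set under the supremum in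
  \<open>trace_norm\<close> bounded above.\<close>

lemma trace_unitary_le:
  assumes "finite I" "unitary_on I U"
  shows "cmod (\<Sum>x\<in>I. \<Sum>y\<in>I. U x y * A y x) \<le> (\<Sum>x\<in>I. \<Sum>y\<in>I. cmod (A y x))"
  using assms
  by (intro sum_norm_le) (auto simp: norm_mult intro!: mult_left_le_one_le unitary_on_entry_le)

lemma trace_norm_upper:
  assumes "finite I" "unitary_on I U"
  shows "cmod (\<Sum>x\<in>I. \<Sum>y\<in>I. U x y * A y x) \<le> trace_norm I A"
  unfolding trace_norm_def
  using assms trace_unitary_le[OF assms(1)]
  by (intro cSUP_upper bdd_aboveI2) auto

lemma unitary_on_one: "finite I \<Longrightarrow> unitary_on I (\<lambda>x y. if x = y then 1 else 0)"
  by (auto simp: unitary_on_def sum_delta_mult(1))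

lemma trace_norm_le:
  assumes "finite I"
  shows "trace_norm I A \<le> (\<Sum>x\<in>I. \<Sum>y\<in>I. cmod (A y x))"
  unfolding trace_norm_def
  using unitary_on_one[OF assms] trace_unitary_le[OF assms]
  by (intro cSUP_least) auto

lemma trace_norm_nonneg: "finite I \<Longrightarrow> 0 \<le> trace_norm I A"
  using trace_norm_upper[OF _ unitary_on_one] by (meson norm_ge_zero order_trans)

subsection \<open>Universality of two-qubit gates\<close>

text \<open>\<^const>\<open>circuit_complexity\<close> is a LEAST, hence unspecified for a state that no circuit prepares.
  On at least two qubits there is no such state.\<close>

definition implementable :: "nat \<Rightarrow> (qvec \<Rightarrow> qvec) \<Rightarrow> bool" where
  "implementable n F \<longleftrightarrow> (\<exists>ls. (\<forall>L\<in>set ls. valid_layer n L) \<and>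
     (\<forall>\<psi>. \<forall>x\<in>reg n. apply_circuit n ls \<psi> x = F \<psi> x))"

lemma apply_circuit_cong:
  assumes "\<And>x. x \<in> reg n \<Longrightarrow> \<psi> x = \<phi> x" "x \<in> reg n"
  shows "apply_circuit n ls \<psi> x = apply_circuit n ls \<phi> x"
proof -
  have "apply_layer n gs \<psi> x = apply_layer n gs \<phi> x" if "x \<in> reg n" for gs x
    using that
  proof (induction gs arbitrary: x)
    case (Cons G gs)
    then show ?case by (simp add: apply_op_def)
  qed (simp add: assms)
  then show ?thesis using assms(2) by (simp add: apply_circuit_concat)
qed

lemma implementable_cong:
  assumes "implementable n F" "\<And>\<psi> x. x \<in> reg n \<Longrightarrow> F \<psi> x = F' \<psi> x"
  shows "implementable n F'"
  using assms unfolding implementable_def by metis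

lemma implementable_comp:
  assumes "implementable n F" "implementable n F'"
  shows "implementable n (\<lambda>\<psi>. F (F' \<psi>))"
proof -
  obtain ls where ls: "\<forall>L\<in>set ls. valid_layer n L" "\<And>\<psi> x. x \<in> reg n \<Longrightarrow> apply_circuit n ls \<psi> x = F \<psi> x"
    using assms(1) unfolding implementable_def by blast
  obtain ls' where ls': "\<forall>L\<in>set ls'. valid_layer n L" "\<And>\<psi> x. x \<in> reg n \<Longrightarrow> apply_circuit n ls' \<psi> x = F' \<psi> x"
    using assms(2) unfolding implementable_def by blast
  have "apply_circuit n (ls @ ls') \<psi> x = F (F' \<psi>) x" if x: "x \<in> reg n" for \<psi> x
  proof -
    have "apply_circuit n (ls @ ls') \<psi> x = apply_circuit n ls (apply_circuit n ls' \<psi>) x"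
      by (simp add: apply_circuit_def)
    also have "\<dots> = apply_circuit n ls (F' \<psi>) x"
      by (rule apply_circuit_cong[OF ls'(2) x])
    finally show ?thesis using ls(2)[OF x] by simp
  qed
  then show ?thesis
    unfolding implementable_def using ls(1) ls'(1) by (intro exI[of _ "ls @ ls'"]) auto
qed

lemma implementable_gate:
  assumes "a < n" "b < n" "a \<noteq> b" "unitary2 g"
  shows "implementable n (\<lambda>\<psi> x. \<Sum>r\<in>UNIV. \<Sum>s\<in>UNIV. g (x a) (x b) r s * \<psi> (x(a := r, b := s)))"
  unfolding implementable_def
  by (intro exI[of _ "[[(a, b, g)]]"])
    (use assms in \<open>auto simp: valid_layer_def apply_circuit_concat apply_gate\<close>)

text \<open>Circuits contain two-qubit gates only, so \<open>u\<close> is tensored with the identity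
  on an idle partner qubit, which exists since \<open>2 \<le> n\<close>.\<close>

lemma implementable_single:
  assumes n: "2 \<le> n" "t < n"
    and u: "\<And>p p'. (\<Sum>r\<in>UNIV. u p r * cnj (u p' r)) = (if p = p' then 1 else 0)"
  shows "implementable n (\<lambda>\<psi> x. \<Sum>r\<in>UNIV. u (x t) r * \<psi> (x(t := r)))"
proof -
  define s where "s = (if t = 0 then 1 else 0 :: nat)"
  have s: "s < n" "t \<noteq> s" using n by (auto simp: s_def)
  define g where "g = (\<lambda>p (q::bool) r s. u p r * (if q = s then 1 else 0))"
  have "unitary2 g"
    unfolding unitary2_def
  proof (intro allI)
    fix p q p' q'
    have "(\<Sum>r\<in>UNIV. \<Sum>s\<in>UNIV. g p q r s * cnj (g p' q' r s)) =
        (if q = q' then (\<Sum>r\<in>UNIV. u p r * cnj (u p' r)) else 0)"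
      by (cases q; cases q') (simp_all add: g_def sum_UNIV_bool)
    then show "(\<Sum>r\<in>UNIV. \<Sum>s\<in>UNIV. g p q r s * cnj (g p' q' r s)) = (if p = p' \<and> q = q' then 1 else 0)"
      unfolding u by auto
  qed
  from implementable_gate[OF n(2) s(1,2) this] show ?thesis
  proof (rule implementable_cong)
    fix \<psi> :: qvec and x :: config
    have "x(t := r, s := x s) = x(t := r)" for r
      using s by (auto simp: fun_eq_iff)
    then show "(\<Sum>r\<in>UNIV. \<Sum>sa\<in>UNIV. g (x t) (x s) r sa * \<psi> (x(t := r, s := sa))) =
        (\<Sum>r\<in>UNIV. u (x t) r * \<psi> (x(t := r)))"
      by (cases "x s") (simp_all add: g_def sum_UNIV_bool)
  qed
qed

lemma implementable_cnot:
  assumes "c < n" "t < n" "c \<noteq> t"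
  shows "implementable n (\<lambda>\<psi> x. \<psi> (x(t := (x t \<noteq> x c))))"
proof -
  define g :: "bool \<Rightarrow> bool \<Rightarrow> bool \<Rightarrow> bool \<Rightarrow> complex"
    where "g = (\<lambda>p q r s. if r = p \<and> s = (q \<noteq> p) then 1 else 0)"
  have "unitary2 g"
    unfolding unitary2_def by (simp add: g_def sum_UNIV_bool all_bool_eq)
  from implementable_gate[OF assms this] show ?thesis
  proof (rule implementable_cong)
    fix \<psi> :: qvec and x :: config
    have "x(c := x c, t := r) = x(t := r)" for r
      using assms by (auto simp: fun_eq_iff)
    then show "(\<Sum>r\<in>UNIV. \<Sum>s\<in>UNIV. g (x c) (x t) r s * \<psi> (x(c := r, t := s))) = \<psi> (x(t := (x t \<noteq> x c)))"
      by (cases "x c"; cases "x t") (simp_all add: g_def sum_UNIV_bool)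
  qed
qed

section \<open>Diagonal unitaries\<close>

abbreviation phase_op :: "(config \<Rightarrow> real) \<Rightarrow> qvec \<Rightarrow> qvec" where
  "phase_op f \<equiv> \<lambda>\<psi> x. cis (f x) * \<psi> x"

lemma implementable_phase_cong:
  assumes "implementable n (phase_op f)" "\<And>x. x \<in> reg n \<Longrightarrow> f x = f' x"
  shows "implementable n (phase_op f')"
  using assms(1) by (rule implementable_cong) (simp add: assms(2))

lemma implementable_phase_add:
  assumes "implementable n (phase_op f)" "implementable n (phase_op f')"
  shows "implementable n (phase_op (\<lambda>x. f x + f' x))"
  using implementable_comp[OF assms] by (rule implementable_cong) (simp add: cis_mult[symmetric])

text \<open>Conjugation by CNOT, an involution on configurations, precomposes the phase function
  with it.\<close>

lemma implementable_phase_cnot: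
  assumes "implementable n (phase_op f)" "c < n" "t < n" "c \<noteq> t"
  shows "implementable n (phase_op (\<lambda>x. f (x(t := (x t \<noteq> x c)))))"
  using implementable_comp[OF implementable_cnot[OF assms(2-4)]
      implementable_comp[OF assms(1) implementable_cnot[OF assms(2-4)]]]
proof (rule implementable_cong)
  fix \<psi> :: qvec and x :: config
  have "(x(t := (x t \<noteq> x c)))(t := ((x(t := (x t \<noteq> x c))) t \<noteq> (x(t := (x t \<noteq> x c))) c)) = x"
    using assms(4) by (auto simp: fun_eq_iff)
  then show "cis (f (x(t := (x t \<noteq> x c)))) *
      \<psi> ((x(t := (x t \<noteq> x c)))(t := ((x(t := (x t \<noteq> x c))) t \<noteq> (x(t := (x t \<noteq> x c))) c))) =
      cis (f (x(t := (x t \<noteq> x c)))) * \<psi> x" by (simp only:)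
qed

lemma implementable_phase_single:
  assumes n: "2 \<le> n" "t < n"
  shows "implementable n (phase_op (\<lambda>x. h (x t)))"
proof -
  have "implementable n (\<lambda>\<psi> x. \<Sum>r\<in>UNIV. (if x t = r then cis (h r) else 0) * \<psi> (x(t := r)))"
    by (rule implementable_single[OF n]) (simp add: sum_UNIV_bool all_bool_eq cis_cnj cis_mult)
  then show ?thesis
  proof (rule implementable_cong)
    fix \<psi> :: qvec and x :: config
    have "x(t := x t) = x" by simp
    then show "(\<Sum>r\<in>UNIV. (if x t = r then cis (h r) else 0) * \<psi> (x(t := r))) = cis (h (x t)) * \<psi> x"
      by (cases "x t") (simp_all add: sum_UNIV_bool)
  qed
qed

text \<open>A CNOT with control c and target in S turns the parity on S into the parity on \<open>insert c S\<close>.\<close>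
lemma implementable_phase_parity:
  assumes n: "2 \<le> n" and S: "S \<subseteq> {0..<n}"
  shows "implementable n (phase_op (\<lambda>x. \<theta> * (\<Prod>i\<in>S. zsign i x)))"
proof (cases "S = {}")
  case True
  then show ?thesis using implementable_phase_single[of n 0 "\<lambda>_. \<theta>"] n by simp
next
  case False
  have "finite S" using S finite_subset by blast
  from this False S show ?thesis
  proof (induction S rule: finite_ne_induct)
    case (singleton t)
    then show ?case
      using implementable_phase_single[of n t "\<lambda>r. \<theta> * (if r then -1 else 1)"] n by (simp add: zsign_def)
  next
    case (insert c S)
    obtain t where t: "t \<in> S" using insert.hyps by blast
    have ct: "c < n" "t < n" "c \<noteq> t" using insert t by auto
    have "(\<Prod>i\<in>S. zsign i (x(t := (x t \<noteq> x c)))) = (\<Prod>i\<in>insert c S. zsign i x)" for x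
    proof -
      define y where "y = x(t := (x t \<noteq> x c))"
      have "(\<Prod>i\<in>S. zsign i y) = zsign t y * (\<Prod>i\<in>S - {t}. zsign i y)"
        using insert.hyps t by (intro prod.remove)
      also have "(\<Prod>i\<in>S - {t}. zsign i y) = (\<Prod>i\<in>S - {t}. zsign i x)"
        by (intro prod.cong) (auto simp: zsign_def y_def)
      also have "zsign t y = zsign c x * zsign t x"
        by (simp add: zsign_def y_def)
      also have "zsign c x * zsign t x * (\<Prod>i\<in>S - {t}. zsign i x) = zsign c x * (\<Prod>i\<in>S. zsign i x)"
        using insert.hyps t by (simp add: prod.remove[of S t])
      also have "\<dots> = (\<Prod>i\<in>insert c S. zsign i x)"
        using insert.hyps by simp
      finally show ?thesis unfolding y_def .
    qed
    note parity = this
    have "implementable n (phase_op (\<lambda>x. \<theta> * (\<Prod>i\<in>S. zsign i x)))"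
      using insert.IH insert.prems by simp
    from implementable_phase_cnot[OF this ct] show ?case
      by (simp only: parity)
  qed
qed

text \<open>Expanding the factor of \<open>t\<close> gives two terms: one keeps the parity set, the
  other moves \<open>t\<close> into \<open>S\<close> and absorbs \<open>a t\<close> into
  \<open>\<theta>\<close>. Hence \<open>S\<close> and \<open>\<theta>\<close> vary in the
  induction.\<close>

lemma implementable_phase_parity_prod:
  assumes n: "2 \<le> n" and "finite T" "S \<subseteq> {0..<n}" "T \<subseteq> {0..<n}" "S \<inter> T = {}"
  shows "implementable n (phase_op (\<lambda>x. \<theta> * (\<Prod>i\<in>T. 1 + a i * zsign i x) * (\<Prod>i\<in>S. zsign i x)))"
  using assms(2-)
proof (induction T arbitrary: S \<theta> rule: finite_induct)
  case empty
  then show ?case using implementable_phase_parity[OF n] by simp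
next
  case (insert t T)
  have fin: "finite S" using insert.prems(1) finite_subset by blast
  have "implementable n (phase_op (\<lambda>x. \<theta> * (\<Prod>i\<in>T. 1 + a i * zsign i x) * (\<Prod>i\<in>S. zsign i x) +
      (\<theta> * a t) * (\<Prod>i\<in>T. 1 + a i * zsign i x) * (\<Prod>i\<in>insert t S. zsign i x)))"
    using insert.prems insert.hyps by (intro implementable_phase_add insert.IH) auto
  moreover have "t \<notin> S" using insert.prems by auto
  ultimately show ?case
    using insert.hyps fin by (simp add: algebra_simps)
qed

text \<open>The product of \<open>1 + zsign i y * zsign i x\<close> over all qubits is
  \<open>2 ^ n\<close> times the indicator of \<open>x = y\<close>, so every phase function is a sum
  of implementable ones.\<close>

lemma implementable_phase:
  assumes n: "2 \<le> n"
  shows "implementable n (phase_op f)"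
proof -
  have delta: "(\<Prod>i\<in>{0..<n}. 1 + zsign i y * zsign i x) = (if x = y then 2 ^ n else 0)"
    if xy: "x \<in> reg n" "y \<in> reg n" for x y
  proof (cases "x = y")
    case True
    then have "(\<Prod>i\<in>{0..<n}. 1 + zsign i y * zsign i x) = (\<Prod>i\<in>{0..<n}. 2)"
      by (intro prod.cong) (auto simp: zsign_def)
    then show ?thesis using True by simp
  next
    case False
    then obtain i where "i \<in> {0..<n}" "x i \<noteq> y i" using cfg_eqI[OF xy] by blast
    then have "(\<Prod>i\<in>{0..<n}. 1 + zsign i y * zsign i x) = 0"
      by (intro prod_zero) (auto simp: zsign_def intro!: bexI[of _ i])
    then show ?thesis using False by simp
  qed
  have "implementable n (phase_op (\<lambda>x. \<Sum>y\<in>A. (if x = y then 1 else 0) * f y))" if "A \<subseteq> reg n" for A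
  proof -
    have "finite A" using that finite_subset by (metis finite_atLeastLessThan finite_cfg)
    from this that show ?thesis
    proof (induction A rule: finite_induct)
      case empty
      then show ?case using implementable_phase_parity[OF n, of "{}" 0] by simp
    next
      case (insert y A)
      have "implementable n (phase_op (\<lambda>x. f y / 2 ^ n * (\<Prod>i\<in>{0..<n}. 1 + zsign i y * zsign i x) *
         (\<Prod>i\<in>{}. zsign i x)))"
        by (rule implementable_phase_parity_prod[OF n]) auto
      then have "implementable n (phase_op (\<lambda>x. (if x = y then 1 else 0) * f y))"
        by (rule implementable_phase_cong) (use insert.prems in \<open>simp add: delta\<close>)
      then show ?case
        using implementable_phase_add insert by simp
    qed
  qed
  then have "implementable n (phase_op (\<lambda>x. \<Sum>y\<in>reg n. (if x = y then 1 else 0) * f y))"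
    by blast
  then show ?thesis
    by (rule implementable_phase_cong) (simp add: sum_delta_mult(1))
qed

text \<open>A real rotation by \<open>\<theta>\<close> is conjugate to \<open>diag(e\<^sup>i\<^sup>\<theta>, e\<^sup>-\<^sup>i\<^sup>\<theta>)\<close> by a matrix u that does not depend on \<open>\<theta>\<close>.\<close>
lemma implementable_multiplexed_rotation:
  assumes n: "2 \<le> n" "t < n" and \<theta>: "\<And>x r. \<theta> (x(t := r)) = \<theta> x"
  shows "implementable n (\<lambda>\<psi> x. if x t
     then of_real (sin (\<theta> x)) * \<psi> (x(t := False)) + of_real (cos (\<theta> x)) * \<psi> (x(t := True))
     else of_real (cos (\<theta> x)) * \<psi> (x(t := False)) - of_real (sin (\<theta> x)) * \<psi> (x(t := True)))"
proof -
  define c :: complex where "c = of_real (1 / sqrt 2)"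
  have cc: "c * c = 1 / 2" and cnjc: "cnj c = c"
    by (simp_all add: c_def flip: of_real_mult)
  \<comment> \<open>The columns are the normalised common eigenvectors (1, -i) and (1, i) of all
    real rotations; \<open>zsign t\<close> supplies the two opposite signs of the angle.\<close>
  define u where "u p r = (if p then (if r then \<i> * c else - \<i> * c) else c)" for p r
  have u1: "implementable n (\<lambda>\<psi> x. \<Sum>r\<in>UNIV. u (x t) r * \<psi> (x(t := r)))"
    by (rule implementable_single[OF n]) (auto simp: sum_UNIV_bool u_def cnjc cc algebra_simps)
  have u2: "implementable n (\<lambda>\<psi> x. \<Sum>r\<in>UNIV. cnj (u r (x t)) * \<psi> (x(t := r)))"
    by (rule implementable_single[OF n]) (auto simp: sum_UNIV_bool u_def cnjc cc algebra_simps)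
  have "implementable n (phase_op (\<lambda>x. \<theta> x * zsign t x))"
    by (rule implementable_phase[OF n(1)])
  from implementable_comp[OF u1 implementable_comp[OF this u2]] show ?thesis
  proof (rule implementable_cong)
    fix \<psi> :: qvec and x :: config
    have cos: "of_real (cos (\<theta> x)) = (cis (\<theta> x) + cis (- \<theta> x)) * (c * c)"
      and sin: "of_real (sin (\<theta> x)) = - \<i> * (cis (\<theta> x) - cis (- \<theta> x)) * (c * c)"
      by (simp_all add: cc complex_eq_iff)
    show "(\<Sum>r\<in>UNIV. u (x t) r * (cis (\<theta> (x(t := r)) * zsign t (x(t := r))) *
        (\<Sum>ra\<in>UNIV. cnj (u ra ((x(t := r)) t)) * \<psi> (x(t := r, t := ra))))) =
      (if x t then of_real (sin (\<theta> x)) * \<psi> (x(t := False)) + of_real (cos (\<theta> x)) * \<psi> (x(t := True))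
       else of_real (cos (\<theta> x)) * \<psi> (x(t := False)) - of_real (sin (\<theta> x)) * \<psi> (x(t := True)))"
      unfolding cos sin
      by (cases "x t") (simp_all add: sum_UNIV_bool u_def zsign_def \<theta> cnjc algebra_simps)
  qed
qed

section \<open>State preparation\<close>

definition preparable :: "nat \<Rightarrow> qvec \<Rightarrow> bool" where
  "preparable n \<psi> \<longleftrightarrow> (\<exists>ls. (\<forall>L\<in>set ls. valid_layer n L) \<and>
      (\<forall>x\<in>reg n. apply_circuit n ls ket0 x = \<psi> x))"

lemma preparable_implementable:
  assumes "preparable n \<psi>" "implementable n F" "\<And>x. x \<in> reg n \<Longrightarrow> F \<psi> x = \<phi> x"
  shows "preparable n \<phi>"
proof -
  obtain ls where ls: "\<forall>L\<in>set ls. valid_layer n L" "\<And>x. x \<in> reg n \<Longrightarrow> apply_circuit n ls ket0 x = \<psi> x"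
    using assms(1) unfolding preparable_def by blast
  obtain ls' where ls': "\<forall>L\<in>set ls'. valid_layer n L" "\<And>\<psi> x. x \<in> reg n \<Longrightarrow> apply_circuit n ls' \<psi> x = F \<psi> x"
    using assms(2) unfolding implementable_def by blast
  have "apply_circuit n (ls' @ ls) ket0 x = \<phi> x" if x: "x \<in> reg n" for x
  proof -
    have "apply_circuit n (ls' @ ls) ket0 x = apply_circuit n ls' (apply_circuit n ls ket0) x"
      by (simp add: apply_circuit_def)
    also have "\<dots> = apply_circuit n ls' \<psi> x"
      by (rule apply_circuit_cong[OF ls(2) x])
    finally show ?thesis using ls'(2)[OF x] assms(3)[OF x] by simp
  qed
  then show ?thesis
    unfolding preparable_def using ls(1) ls'(1) by (intro exI[of _ "ls' @ ls"]) auto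
qed

text \<open>Induction on the number of qubits that may be excited: undo qubit \<open>m\<close> by a
  multiplexed rotation, prepare the rest, then rotate back and restore the phases.\<close>

lemma preparable_support:
  assumes n: "2 \<le> n" and "m \<le> n" "unit_vec n \<psi>" "\<And>x. x \<in> reg n \<Longrightarrow> x \<notin> reg m \<Longrightarrow> \<psi> x = 0"
  shows "preparable n \<psi>"
  using assms(2-)
proof (induction m arbitrary: \<psi>)
  case 0
  let ?z = "\<lambda>_::nat. False"
  have zero: "\<psi> x = 0" if "x \<in> reg n" "x \<noteq> ?z" for x
    using 0(3)[OF that(1)] that(2) by (auto simp: cfg_def fun_eq_iff)
  have "1 = (\<Sum>x\<in>reg n. (cmod (\<psi> x))\<^sup>2)" using 0(2) by (simp add: unit_vec_def)
  also have "\<dots> = (\<Sum>x\<in>{?z}. (cmod (\<psi> x))\<^sup>2)"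
    by (rule sum.mono_neutral_right) (auto simp: zero)
  finally have "(cmod (\<psi> ?z))\<^sup>2 = 1" by simp
  then have "cmod (\<psi> ?z) = 1" by (simp add: power2_eq_1_iff) (smt (verit) norm_ge_zero)
  \<comment> \<open>A unit vector supported on one configuration is \<open>ket0\<close> up to a
    phase.\<close>
  then have "cis (Arg (\<psi> ?z)) = \<psi> ?z"
    using rcis_cmod_Arg[of "\<psi> ?z"] by (simp add: rcis_def)
  moreover have "preparable n ket0"
    unfolding preparable_def by (intro exI[of _ "[]"]) (simp add: apply_circuit_def)
  ultimately show ?case
    using preparable_implementable[OF _ implementable_phase[OF n, of "\<lambda>_. Arg (\<psi> ?z)"]]
    by (simp add: ket0_def zero)
next
  case (Suc m)
  then have m: "m < n" by simp
  \<comment> \<open>Rotate the amplitudes of qubit m together, so that only the first m qubits are excited.\<close>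
  define z where "z x = Complex (cmod (\<psi> (x(m := False)))) (cmod (\<psi> (x(m := True))))" for x
  define \<phi> where "\<phi> x = (if x m then 0 else complex_of_real (cmod (z x)))" for x
  have z_upd: "z (x(m := r)) = z x" for x r by (simp add: z_def)
  have reg: "{0..<n} = insert m ({0..<n} - {m})" using m by auto
  \<comment> \<open>Equality holds pair by pair: the squared modulus of \<open>z x\<close> is the
    sum of those of the two amplitudes that differ in bit \<open>m\<close>.\<close>
  have norm: "(\<Sum>x\<in>reg n. (cmod (\<phi> x))\<^sup>2) = (\<Sum>x\<in>reg n. (cmod (\<psi> x))\<^sup>2)"
  proof -
    have "(cmod (\<phi> x))\<^sup>2 + (cmod (\<phi> (x(m := True))))\<^sup>2 = (cmod (\<psi> x))\<^sup>2 + (cmod (\<psi> (x(m := True))))\<^sup>2"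
      if "x \<in> cfg ({0..<n} - {m})" for x
    proof -
      have "\<not> x m" "x(m := False) = x" using that by (auto simp: cfg_def fun_eq_iff)
      then show ?thesis by (simp add: \<phi>_def z_def cmod_power2)
    qed
    then show ?thesis
      by (subst (1 2) reg, subst (1 2) sum_cfg_insert) (auto intro!: sum.cong)
  qed
  have "preparable n \<phi>"
  proof (rule Suc.IH)
    show "unit_vec n \<phi>" using Suc.prems(2) norm by (simp add: unit_vec_def)
    fix x assume x: "x \<in> reg n" "x \<notin> reg m"
    show "\<phi> x = 0"
    proof (cases "x m")
      case False
      obtain i where i: "i \<ge> m" "x i" using x(2) by (auto simp: cfg_def not_less)
      with False have "i > m" by (cases "i = m") auto
      then have "x(m := r) \<notin> reg (Suc m)" for r
        using i by (auto simp: cfg_def intro!: exI[of _ i])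
      moreover have "x(m := r) \<in> reg n" for r using x(1) m by (simp add: cfg_upd)
      ultimately have "\<psi> (x(m := r)) = 0" for r using Suc.prems(3) by blast
      then show ?thesis by (simp add: \<phi>_def z_def complex_eq_iff)
    qed (simp add: \<phi>_def)
  qed (use m in simp)
  \<comment> \<open>Rotating by \<open>Arg (z x)\<close> splits the modulus of \<open>z x\<close>
    back into its two coordinates. Only moduli are restored here; a diagonal unitary adds the phases
    afterwards.\<close>
  then have "preparable n (\<lambda>x. complex_of_real (cmod (\<psi> x)))"
  proof (rule preparable_implementable[OF _ implementable_multiplexed_rotation[OF n m, where \<theta> = "\<lambda>x. Arg (z x)"]])
    fix x :: config
    have "rcis (cmod (z x)) (Arg (z x)) = z x" by (rule rcis_cmod_Arg)
    then have "cmod (z x) * cos (Arg (z x)) = cmod (\<psi> (x(m := False)))"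
      "cmod (z x) * sin (Arg (z x)) = cmod (\<psi> (x(m := True)))"
      by (simp_all add: complex_eq_iff z_def)
    moreover have "x(m := True) = x" if "x m" using that by (auto simp: fun_eq_iff)
    moreover have "x(m := False) = x" if "\<not> x m" using that by (auto simp: fun_eq_iff)
    ultimately show "(if x m then complex_of_real (sin (Arg (z x))) * \<phi> (x(m := False)) +
          complex_of_real (cos (Arg (z x))) * \<phi> (x(m := True))
        else complex_of_real (cos (Arg (z x))) * \<phi> (x(m := False)) -
          complex_of_real (sin (Arg (z x))) * \<phi> (x(m := True))) = complex_of_real (cmod (\<psi> x))"
      by (simp add: \<phi>_def z_upd mult.commute flip: of_real_mult)
  qed (simp_all add: z_upd)
  then show ?case
  proof (rule preparable_implementable[OF _ implementable_phase[OF n, of "\<lambda>x. Arg (\<psi> x)"]])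
    fix x
    show "cis (Arg (\<psi> x)) * complex_of_real (cmod (\<psi> x)) = \<psi> x"
      using rcis_cmod_Arg[of "\<psi> x"] by (simp add: rcis_def mult.commute)
  qed
qed

lemma preparable_unit_vec:
  assumes "2 \<le> n" "unit_vec n \<psi>"
  shows "preparable n \<psi>"
  using preparable_support[OF assms(1) order_refl assms(2)] by blast

subsection \<open>Entropy bound\<close>

text \<open>Summing out one bit of the product distribution contributes the factor
  \<open>(1 - r) + r = 1\<close>.\<close>

lemma sum_cfg_bernoulli:
  fixes r :: real
  assumes "finite S"
  shows "(\<Sum>x\<in>cfg S. \<Prod>i\<in>S. if x i then r else 1 - r) = 1"
  using assms
proof (induction S rule: finite_induct)
  case empty
  have "cfg {} = {\<lambda>_. False}" by (auto simp: cfg_def)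
  then show ?case by simp
next
  case (insert m S)
  have "(\<Prod>i\<in>insert m S. if x i then r else 1 - r) +
      (\<Prod>i\<in>insert m S. if (x(m := True)) i then r else 1 - r) = (\<Prod>i\<in>S. if x i then r else 1 - r)"
    if "x \<in> cfg S" for x
  proof -
    have "\<not> x m" using that insert.hyps by (simp add: cfg_def)
    moreover have "(\<Prod>i\<in>S. if (x(m := True)) i then r else 1 - r) = (\<Prod>i\<in>S. if x i then r else 1 - r)"
      using insert.hyps by (intro prod.cong) auto
    ultimately show ?thesis
      using insert.hyps by (simp add: algebra_simps)
  qed
  then have "(\<Sum>x\<in>cfg (insert m S). \<Prod>i\<in>insert m S. if x i then r else 1 - r) =
      (\<Sum>x\<in>cfg S. \<Prod>i\<in>S. if x i then r else 1 - r)"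
    unfolding sum_cfg_insert[OF insert.hyps] by (rule sum.cong[OF refl])
  then show ?case using insert.IH by simp
qed

text \<open>Gibbs' inequality against the product distribution w: since \<open>p x \<le> 2\<^sup>-\<^sup>k\<close>, the entropy of p
  is at least k, and the cross entropy with w only depends on the marginals.\<close>
lemma min_entropy_le_marginals:
  fixes p :: "config \<Rightarrow> real"
  assumes p0: "\<And>x. x \<in> reg n \<Longrightarrow> 0 \<le> p x" and p1: "(\<Sum>x\<in>reg n. p x) = 1"
    and pk: "\<And>x. x \<in> reg n \<Longrightarrow> p x \<le> 1 / 2 ^ k"
    and marg: "\<And>i. i < n \<Longrightarrow> (\<Sum>x\<in>reg n. if x i then p x else 0) \<le> r"
    and r: "0 \<le> r" "r < 1 / 2"
  shows "real k \<le> real n * H2 r"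
proof (cases "r = 0")
  case True
  have "p x = 0" if x: "x \<in> reg n" "x \<noteq> (\<lambda>_. False)" for x
  proof -
    obtain i where i: "x i" using x(2) by (auto simp: fun_eq_iff)
    then have "i < n" using x(1) by (force simp: cfg_def)
    have "(if x i then p x else 0) \<le> (\<Sum>x\<in>reg n. if x i then p x else 0)"
      by (rule member_le_sum) (use x p0 in auto)
    then show ?thesis using marg[OF \<open>i < n\<close>] True p0[OF x(1)] i by simp
  qed
  then have "(\<Sum>x\<in>reg n. p x) = (\<Sum>x\<in>{\<lambda>_. False}. p x)"
    by (intro sum.mono_neutral_right) auto
  then have "1 \<le> 1 / (2::real) ^ k" using p1 pk[of "\<lambda>_. False"] by simp
  then have "(2::real) ^ k \<le> 2 ^ 0" by (simp add: field_simps)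
  then have "k = 0" by (simp only: power_increasing_iff)
  then show ?thesis using True by (simp add: H2_def)
next
  case False
  with r have r: "0 < r" "r < 1 / 2" by auto
  define w where "w x = (\<Prod>i\<in>{0..<n}. if x i then r else 1 - r)" for x
  \<comment> \<open>The log odds of \<open>r\<close>; they are nonpositive as
    \<open>r < 1 / 2\<close>, so upper bounds on marginals become lower bounds after multiplication
    by \<open>D\<close>.\<close>
  define D where "D = ln r - ln (1 - r)"
  have D: "D \<le> 0" using r by (simp add: D_def)
  have w: "w x > 0" for x unfolding w_def using r by (intro prod_pos) auto
  \<comment> \<open>This is \<open>ln t \<le> t - 1\<close> at \<open>t = w x / p x\<close>, after
    bounding \<open>2 ^ k\<close> by \<open>1 / p x\<close>.\<close>
  have pw: "p x * (ln (w x) + k * ln 2) \<le> w x - p x" if x: "x \<in> reg n" for x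
  proof (cases "p x = 0")
    case True
    then show ?thesis using w[of x] by simp
  next
    case False
    then have px: "p x > 0" using p0[OF x] by simp
    have "ln (w x) + k * ln 2 = ln (w x * 2 ^ k)"
      using w[of x] by (simp add: ln_mult ln_realpow)
    also have "\<dots> \<le> ln (w x / p x)"
      using pk[OF x] px w[of x] by (simp add: field_simps)
    also have "\<dots> \<le> w x / p x - 1"
      using px w[of x] by (intro ln_le_minus_one) simp
    finally have "p x * (ln (w x) + k * ln 2) \<le> p x * (w x / p x - 1)"
      using px by (intro mult_left_mono) auto
    then show ?thesis using px by (simp add: algebra_simps)
  qed
  \<comment> \<open>The logarithm of \<open>w\<close> is affine in the bits, so its mean under
    \<open>p\<close> sees only the marginals.\<close>
  have lnw: "ln (w x) = (\<Sum>i\<in>{0..<n}. ln (1 - r) + (if x i then D else 0))" for x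
    unfolding w_def using r by (subst ln_prod) (auto simp: D_def intro!: sum.cong)
  have "(\<Sum>x\<in>reg n. p x * ln (w x)) =
      (\<Sum>i\<in>{0..<n}. \<Sum>x\<in>reg n. p x * ln (1 - r) + (if x i then p x else 0) * D)"
    unfolding lnw sum_distrib_left
    by (subst sum.swap) (auto intro!: sum.cong simp: algebra_simps)
  also have "\<dots> = (\<Sum>i\<in>{0..<n}. ln (1 - r) + (\<Sum>x\<in>reg n. if x i then p x else 0) * D)"
    by (simp add: sum.distrib sum_distrib_right[symmetric] p1)
  also have "\<dots> \<ge> (\<Sum>i\<in>{0..<n}. ln (1 - r) + r * D)"
    using marg D by (intro sum_mono add_mono mult_right_mono_neg) auto
  finally have "n * (ln (1 - r) + r * D) \<le> (\<Sum>x\<in>reg n. p x * ln (w x))" by simp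
  \<comment> \<open>Both distributions have total mass 1, so the right side is zero.\<close>
  moreover have "(\<Sum>x\<in>reg n. p x * (ln (w x) + k * ln 2)) \<le> (\<Sum>x\<in>reg n. w x - p x)"
    by (rule sum_mono[OF pw])
  then have "(\<Sum>x\<in>reg n. p x * ln (w x)) + k * ln 2 \<le> 0"
    using sum_cfg_bernoulli[of "{0..<n}" r]
    by (simp add: distrib_left sum.distrib sum_subtractf sum_distrib_right[symmetric] p1 w_def)
  ultimately have "k * ln 2 \<le> n * (- (ln (1 - r) + r * D))" by (simp only: mult_minus_right)
  moreover have "H2 r * ln 2 = - (ln (1 - r) + r * D)"
    by (simp add: H2_def D_def log_def field_simps)
  ultimately have "k * ln 2 \<le> (n * H2 r) * ln 2" by (simp only: mult.assoc)
  then show ?thesis by simp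
qed

subsection \<open>Marginals of the code state\<close>

lemma inner_q_cong:
  "(\<And>x. x \<in> reg n \<Longrightarrow> \<phi> x = \<phi>' x) \<Longrightarrow> (\<And>x. x \<in> reg n \<Longrightarrow> \<psi> x = \<psi>' x) \<Longrightarrow>
   inner_q n \<phi> \<psi> = inner_q n \<phi>' \<psi>'"
  by (simp add: inner_q_def)

lemma inner_q_cnj: "inner_q n \<psi> \<phi> = cnj (inner_q n \<phi> \<psi>)"
  by (simp add: inner_q_def mult.commute)

lemma inner_q_self: "inner_q n \<psi> \<psi> = of_real (\<Sum>x\<in>reg n. (cmod (\<psi> x))\<^sup>2)"
  unfolding inner_q_def of_real_sum complex_norm_square by (simp add: mult.commute)

lemma inner_q_combination:
  "inner_q n \<phi> (\<lambda>x. \<psi> x - (\<Sum>j\<in>J. c j * b j x)) = inner_q n \<phi> \<psi> - (\<Sum>j\<in>J. c j * inner_q n \<phi> (b j))"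
proof -
  have "(\<Sum>x\<in>reg n. \<Sum>j\<in>J. cnj (\<phi> x) * (c j * b j x)) = (\<Sum>j\<in>J. c j * inner_q n \<phi> (b j))"
    unfolding inner_q_def sum_distrib_left by (subst sum.swap) (simp add: mult_ac)
  then show ?thesis
    by (simp add: inner_q_def right_diff_distrib sum_subtractf sum_distrib_left)
qed

text \<open>The residual \<open>v\<close> of \<open>\<phi>\<close> after projection is orthogonal to
  the family, so its squared norm is 1 minus the sum of squared coefficients, and this is
  nonnegative.\<close>

lemma bessel_inequality:
  assumes "finite J" and b: "\<And>i j. i \<in> J \<Longrightarrow> j \<in> J \<Longrightarrow> inner_q n (b i) (b j) = (if i = j then 1 else 0)"
    and \<phi>: "inner_q n \<phi> \<phi> = 1"
  shows "(\<Sum>j\<in>J. (cmod (inner_q n \<phi> (b j)))\<^sup>2) \<le> 1"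
proof -
  define c where "c j = inner_q n (b j) \<phi>" for j
  define v where "v x = \<phi> x - (\<Sum>j\<in>J. c j * b j x)" for x
  have v: "inner_q n \<psi> v = inner_q n \<psi> \<phi> - (\<Sum>j\<in>J. c j * inner_q n \<psi> (b j))" for \<psi>
    unfolding v_def by (rule inner_q_combination)
  have bv: "inner_q n (b i) v = 0" if "i \<in> J" for i
  proof -
    have "(\<Sum>j\<in>J. c j * inner_q n (b i) (b j)) = (\<Sum>j\<in>J. (if i = j then 1 else 0) * c j)"
      using b[OF that] by (intro sum.cong) auto
    then show ?thesis
      using sum_delta_mult(1)[OF assms(1) that, of c] by (simp add: v c_def)
  qed
  have "inner_q n v v = inner_q n v \<phi> - (\<Sum>j\<in>J. c j * inner_q n v (b j))" by (rule v)
  also have "\<dots> = inner_q n v \<phi>"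
    using bv by (simp add: inner_q_cnj[of n v])
  also have "\<dots> = cnj (inner_q n \<phi> v)" by (rule inner_q_cnj)
  also have "\<dots> = 1 - (\<Sum>j\<in>J. cnj (c j * cnj (c j)))"
    by (simp add: v \<phi> c_def inner_q_cnj[of n \<phi> "b _"])
  also have "\<dots> = of_real (1 - (\<Sum>j\<in>J. (cmod (c j))\<^sup>2))"
    unfolding of_real_diff of_real_sum complex_norm_square by (simp add: mult.commute)
  finally have "complex_of_real (\<Sum>x\<in>reg n. (cmod (v x))\<^sup>2) = of_real (1 - (\<Sum>j\<in>J. (cmod (c j))\<^sup>2))"
    unfolding inner_q_self .
  then have "(\<Sum>x\<in>reg n. (cmod (v x))\<^sup>2) = 1 - (\<Sum>j\<in>J. (cmod (c j))\<^sup>2)"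
    unfolding of_real_eq_iff .
  moreover have "0 \<le> (\<Sum>x\<in>reg n. (cmod (v x))\<^sup>2)" by (intro sum_nonneg) simp
  ultimately show ?thesis
    by (simp add: c_def inner_q_cnj[of n "b _" \<phi>])
qed

lemma parseval:
  assumes "\<forall>G\<in>set gs. valid_gate n G"
  shows "(\<Sum>x\<in>reg n. (cmod (inner_q n (apply_layer n gs (ket x)) \<beta>))\<^sup>2) = (\<Sum>x\<in>reg n. (cmod (\<beta> x))\<^sup>2)"
proof -
  have "(\<Sum>x\<in>reg n. complex_of_real ((cmod (inner_q n (apply_layer n gs (ket x)) \<beta>))\<^sup>2)) =
     (\<Sum>y\<in>reg n. \<Sum>z\<in>reg n. obs n gs (\<lambda>_. 1) y z * proj \<beta> z y)"
    by (simp add: trace_obs_proj)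
  also have "\<dots> = (\<Sum>y\<in>reg n. \<Sum>z\<in>reg n. (if y = z then 1 else 0) * proj \<beta> z y)"
    by (intro sum.cong refl) (simp add: obs_one[OF assms])
  also have "\<dots> = (\<Sum>y\<in>reg n. complex_of_real ((cmod (\<beta> y))\<^sup>2))"
    unfolding complex_norm_square
    by (intro sum.cong refl) (simp add: sum_delta_mult(1) proj_def)
  finally show ?thesis unfolding of_real_sum[symmetric] of_real_eq_iff .
qed

section \<open>Boundedness of the subsystem variance\<close>

lemma unit_vec_entry_le: "unit_vec n \<psi> \<Longrightarrow> x \<in> reg n \<Longrightarrow> cmod (\<psi> x) \<le> 1"
proof -
  assume "unit_vec n \<psi>" "x \<in> reg n"
  then have "(cmod (\<psi> x))\<^sup>2 \<le> 1\<^sup>2"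
    using member_le_sum[of x "reg n" "\<lambda>x. (cmod (\<psi> x))\<^sup>2"] by (simp add: unit_vec_def)
  then show ?thesis by (rule power2_le_imp_le) simp
qed

lemma proj_entry_le: "unit_vec n \<psi> \<Longrightarrow> x \<in> reg n \<Longrightarrow> y \<in> reg n \<Longrightarrow> cmod (proj \<psi> x y) \<le> 1"
  by (simp add: proj_def norm_mult mult_le_one unit_vec_entry_le)

lemma unit_vec_iff: "unit_vec n \<psi> \<longleftrightarrow> inner_q n \<psi> \<psi> = 1"
  unfolding inner_q_self unit_vec_def of_real_eq_1_iff ..

lemma code_basis_unit: "is_code n k b \<Longrightarrow> j < 2 ^ k \<Longrightarrow> unit_vec n (b j)"
  by (simp add: unit_vec_iff is_code_def)

lemma code_mixed_entry_le:
  assumes "is_code n k b" "x \<in> reg n" "y \<in> reg n"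
  shows "cmod (code_mixed k b x y) \<le> 1"
proof -
  have "cmod (\<Sum>j<2^k. proj (b j) x y) \<le> (\<Sum>j<(2::nat)^k. 1)"
    using assms by (intro sum_norm_le proj_entry_le[of n] code_basis_unit) auto
  then show ?thesis by (simp add: code_mixed_def norm_divide norm_power)
qed

lemma ptrace_entry_le:
  assumes \<rho>: "\<And>x y. x \<in> reg n \<Longrightarrow> y \<in> reg n \<Longrightarrow> cmod (\<rho> x y) \<le> 1"
    and S: "S \<subseteq> {0..<n}" and xy: "x \<in> cfg S" "y \<in> cfg S"
  shows "cmod (ptrace n S \<rho> x y) \<le> card (reg n)"
proof -
  have "cmod (ptrace n S \<rho> x y) \<le> (\<Sum>z\<in>cfg ({0..<n} - S). 1)"
    unfolding ptrace_def
  proof (intro sum_norm_le \<rho>)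
    fix z assume "z \<in> cfg ({0..<n} - S)"
    then show "merge S x z \<in> reg n" "merge S y z \<in> reg n"
      using xy S by (auto simp: cfg_def merge_def)
  qed
  moreover have "card (cfg ({0..<n} - S)) \<le> card (reg n)"
    by (intro card_mono cfg_mono) auto
  ultimately show ?thesis by simp
qed

text \<open>A real supremum dominates its members only once the set is known to be bounded;
  entrywise bounds give one that is uniform in the state and in \<open>S\<close>.\<close>

lemma subsys_var_upper:
  assumes code: "is_code n k b" and \<psi>: "in_code n k b \<psi>" "unit_vec n \<psi>"
    and S: "S \<subseteq> {0..<n}" "card S \<le> d"
  shows "trace_norm (cfg S) (\<lambda>x y. ptrace n S (proj \<psi>) x y - ptrace n S (code_mixed k b) x y)
      \<le> subsys_var_all n k b d"
  unfolding subsys_var_all_def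
proof (rule cSup_upper)
  show "bdd_above {trace_norm (cfg S)
        (\<lambda>x y. ptrace n S (proj \<psi>) x y - ptrace n S (code_mixed k b) x y) | \<psi> S.
        in_code n k b \<psi> \<and> unit_vec n \<psi> \<and> S \<subseteq> {0..<n} \<and> card S \<le> d}"
  proof (rule bdd_aboveI, clarify)
    fix \<psi> S assume \<psi>: "unit_vec n \<psi>" and S: "S \<subseteq> {0..<n}"
    let ?N = "real (card (reg n))"
    have fin: "finite (cfg S)" by (meson S finite_atLeastLessThan finite_cfg finite_subset)
    have "trace_norm (cfg S) (\<lambda>x y. ptrace n S (proj \<psi>) x y - ptrace n S (code_mixed k b) x y)
        \<le> (\<Sum>x\<in>cfg S. \<Sum>y\<in>cfg S. cmod (ptrace n S (proj \<psi>) y x - ptrace n S (code_mixed k b) y x))"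
      by (rule trace_norm_le[OF fin])
    also have "\<dots> \<le> (\<Sum>x\<in>cfg S. \<Sum>y\<in>cfg S. ?N + ?N)"
      using S \<psi> code
      by (intro sum_mono order_trans[OF norm_triangle_ineq4] add_mono ptrace_entry_le)
        (auto intro: proj_entry_le code_mixed_entry_le)
    also have "\<dots> \<le> (\<Sum>x\<in>reg n. \<Sum>y\<in>reg n. ?N + ?N)"
      using card_mono[OF _ cfg_mono[OF S]] by (simp only: sum_constant) (intro mult_mono, auto)
    finally show "trace_norm (cfg S) (\<lambda>x y. ptrace n S (proj \<psi>) x y - ptrace n S (code_mixed k b) x y)
        \<le> (\<Sum>x\<in>reg n. \<Sum>y\<in>reg n. ?N + ?N)" .
  qed
qed (use \<psi> S in blast)

text \<open>The output distribution of undoing the circuit on the maximally mixed code state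
  and measuring in the computational basis.\<close>
definition unprep_dist :: "nat \<Rightarrow> nat \<Rightarrow> (nat \<Rightarrow> qvec) \<Rightarrow> gate list \<Rightarrow> config \<Rightarrow> real" where
  "unprep_dist n k b gs x = (\<Sum>j<2^k. (cmod (inner_q n (apply_layer n gs (ket x)) (b j)))\<^sup>2) / 2 ^ k"

lemma unprep_dist_nonneg: "0 \<le> unprep_dist n k b gs x"
  by (simp add: unprep_dist_def sum_nonneg)

text \<open>Each evolved basis state is a unit vector, so Bessel bounds its total overlap with the
  code basis by 1. This is where the code dimension enters the entropy bound.\<close>

lemma unprep_dist_le:
  assumes code: "is_code n k b" and gs: "\<forall>G\<in>set gs. valid_gate n G" and x: "x \<in> reg n"
  shows "unprep_dist n k b gs x \<le> 1 / 2 ^ k"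
proof -
  have "(\<Sum>j<2^k. (cmod (inner_q n (apply_layer n gs (ket x)) (b j)))\<^sup>2) \<le> 1"
    using code by (intro bessel_inequality) (auto simp: is_code_def inner_q_apply_layer[OF gs] inner_q_ket[OF x x])
  then show ?thesis by (simp add: unprep_dist_def divide_right_mono)
qed

lemma sum_unprep_dist:
  assumes code: "is_code n k b" and gs: "\<forall>G\<in>set gs. valid_gate n G"
  shows "(\<Sum>x\<in>reg n. unprep_dist n k b gs x) = 1"
proof -
  have "(\<Sum>x\<in>reg n. \<Sum>j<2^k. (cmod (inner_q n (apply_layer n gs (ket x)) (b j)))\<^sup>2) = (\<Sum>j<(2::nat)^k. 1)"
    using code_basis_unit[OF code]
    by (subst sum.swap) (intro sum.cong, auto simp: parseval[OF gs] unit_vec_def)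
  then show ?thesis
    by (simp add: unprep_dist_def sum_divide_distrib[symmetric])
qed

lemma trace_obs_code_mixed:
  "(\<Sum>y\<in>reg n. \<Sum>z\<in>reg n. obs n gs w y z * code_mixed k b z y) =
   (\<Sum>x\<in>reg n. w x * of_real (unprep_dist n k b gs x))"
proof -
  let ?f = "\<lambda>x j. w x * complex_of_real ((cmod (inner_q n (apply_layer n gs (ket x)) (b j)))\<^sup>2)"
  have "(\<Sum>y\<in>reg n. \<Sum>z\<in>reg n. obs n gs w y z * code_mixed k b z y) =
     (\<Sum>y\<in>reg n. \<Sum>z\<in>reg n. \<Sum>j<2^k. obs n gs w y z * proj (b j) z y) / 2 ^ k"
    by (simp add: code_mixed_def sum_distrib_left sum_divide_distrib)
  also have "(\<Sum>y\<in>reg n. \<Sum>z\<in>reg n. \<Sum>j<2^k. obs n gs w y z * proj (b j) z y) =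
     (\<Sum>y\<in>reg n. \<Sum>j<2^k. \<Sum>z\<in>reg n. obs n gs w y z * proj (b j) z y)"
    by (rule sum.cong[OF refl], rule sum.swap)
  also have "\<dots> = (\<Sum>j<2^k. \<Sum>y\<in>reg n. \<Sum>z\<in>reg n. obs n gs w y z * proj (b j) z y)"
    by (rule sum.swap)
  also have "\<dots> = (\<Sum>j<2^k. \<Sum>x\<in>reg n. ?f x j)"
    unfolding trace_obs_proj ..
  also have "\<dots> = (\<Sum>x\<in>reg n. \<Sum>j<2^k. ?f x j)"
    by (rule sum.swap)
  finally show ?thesis
    by (simp add: unprep_dist_def sum_distrib_left sum_divide_distrib)
qed

text \<open>The evolved Z on qubit \<open>i\<close> has expectation 1 in \<open>\<psi>'\<close>. Its
  expectation drops by at most \<open>\<delta>\<close> on passing to \<open>\<psi>\<close>, then by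
  at most the variance on passing to the mixed code state.\<close>

lemma unprep_dist_marginal:
  assumes code: "is_code n k b" and \<psi>: "in_code n k b \<psi>" "unit_vec n \<psi>"
    and ls: "\<forall>L\<in>set ls. valid_layer n L" "2 ^ length ls \<le> d"
    and \<psi>': "\<And>x. x \<in> reg n \<Longrightarrow> apply_circuit n ls ket0 x = \<psi>' x"
    and close: "trace_norm (reg n) (\<lambda>x y. proj \<psi>' x y - proj \<psi> x y) \<le> \<delta>"
    and i: "i < n"
  shows "(\<Sum>x\<in>reg n. if x i then unprep_dist n k b (concat ls) x else 0) \<le> subsys_var_all n k b d / 2 + \<delta> / 2"
proof -
  define gs where "gs = concat ls"
  define M where "M = obs n gs (\<lambda>x. of_real (zsign i x))"
  define E where "E \<rho> = (\<Sum>y\<in>reg n. \<Sum>z\<in>reg n. M y z * \<rho> z y)" for \<rho>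
  define T where "T = (\<Sum>x\<in>reg n. zsign i x * unprep_dist n k b gs x)"
  have gs: "\<forall>G\<in>set gs. valid_gate n G"
    using ls(1) valid_layer_gates by (auto simp: gs_def)
  obtain S where S: "S \<subseteq> {0..<n}" "card S \<le> 2 ^ length ls"
    and M: "\<And>j. j < n \<Longrightarrow> j \<notin> S \<Longrightarrow> trivial_at n j M"
    using circuit_light_cone[OF ls(1) i] unfolding M_def gs_def by blast
  have U: "unitary_on (reg n) M"
    unfolding M_def by (rule unitary_on_obs[OF gs]) (simp add: zsign_def)
  have fin: "finite (cfg S)" by (meson S(1) finite_atLeastLessThan finite_cfg finite_subset)
  \<comment> \<open>Undoing the circuit on \<open>\<psi>'\<close> gives the all-False string with
    certainty, and there \<open>zsign i\<close> is 1.\<close>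
  have E\<psi>': "E (proj \<psi>') = 1"
  proof -
    have "inner_q n (apply_layer n gs (ket x)) \<psi>' = (if (\<lambda>_. False) = x then 1 else 0)" if x: "x \<in> reg n" for x
    proof -
      have "inner_q n (apply_layer n gs (ket x)) \<psi>' =
         inner_q n (apply_layer n gs (ket x)) (apply_layer n gs (ket (\<lambda>_. False)))"
        by (rule inner_q_cong) (simp_all add: \<psi>'[symmetric] apply_circuit_concat gs_def ket0_eq)
      then show ?thesis
        using inner_q_apply_layer[OF gs] inner_q_ket[OF x] by auto
    qed
    then have "E (proj \<psi>') = (\<Sum>x\<in>reg n. (if (\<lambda>_. False) = x then 1 else 0) * of_real (zsign i x))"
      unfolding E_def M_def trace_obs_proj by (intro sum.cong) auto
    then show ?thesis by (simp add: sum_delta_mult(1) zsign_def)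
  qed
  have "E (proj \<psi>') - E (proj \<psi>) = (\<Sum>y\<in>reg n. \<Sum>z\<in>reg n. M y z * (proj \<psi>' z y - proj \<psi> z y))"
    by (simp add: E_def right_diff_distrib sum_subtractf)
  then have 1: "cmod (E (proj \<psi>') - E (proj \<psi>)) \<le> \<delta>"
    using trace_norm_upper[OF _ U, of "\<lambda>x y. proj \<psi>' x y - proj \<psi> x y"] close by simp
  \<comment> \<open>The light cone makes only the reduced states on \<open>S\<close> matter, and
    \<open>card S \<le> d\<close> lets the variance control their difference.\<close>
  have E_reduced: "E \<rho> = (\<Sum>x\<in>cfg S. \<Sum>y\<in>cfg S. M x y * ptrace n S \<rho> y x)" for \<rho>
    unfolding E_def by (rule trace_reduced[OF S(1) M])
  have "E (proj \<psi>) - E (code_mixed k b) = (\<Sum>x\<in>cfg S. \<Sum>y\<in>cfg S.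
      M x y * (ptrace n S (proj \<psi>) y x - ptrace n S (code_mixed k b) y x))"
    unfolding E_reduced by (simp add: right_diff_distrib sum_subtractf)
  then have 2: "cmod (E (proj \<psi>) - E (code_mixed k b)) \<le> subsys_var_all n k b d"
    using trace_norm_upper[OF fin unitary_on_reduced[OF S(1) M U],
        of "\<lambda>x y. ptrace n S (proj \<psi>) x y - ptrace n S (code_mixed k b) x y"]
      subsys_var_upper[OF code \<psi> S(1) order_trans[OF S(2) ls(2)]] by simp
  have "E (code_mixed k b) = of_real T"
    by (simp add: E_def M_def trace_obs_code_mixed T_def)
  then have "cmod (of_real (1 - T)) \<le> \<delta> + subsys_var_all n k b d"
    using norm_triangle_ineq[of "E (proj \<psi>') - E (proj \<psi>)" "E (proj \<psi>) - E (code_mixed k b)"] 1 2 E\<psi>' by simp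
  then have "1 - T \<le> \<delta> + subsys_var_all n k b d"
    unfolding norm_of_real by simp
  \<comment> \<open>Since \<open>zsign i\<close> is 1 minus twice the bit, \<open>T\<close> is 1
    minus twice the marginal, which explains the halves in the bound.\<close>
  moreover have "T = (\<Sum>x\<in>reg n. unprep_dist n k b gs x - 2 * (if x i then unprep_dist n k b gs x else 0))"
    unfolding T_def by (intro sum.cong) (auto simp: zsign_def)
  then have "T = 1 - 2 * (\<Sum>x\<in>reg n. if x i then unprep_dist n k b gs x else 0)"
    by (simp only: sum_subtractf sum_unprep_dist[OF code gs] sum_distrib_left[symmetric])
  ultimately show ?thesis unfolding gs_def[symmetric] by simp
qed

text \<open>The empty set of qubits is always admissible, and its trace norm is nonnegative.\<close>

lemma subsys_var_nonneg:
  assumes "is_code n k b" "in_code n k b \<psi>" "unit_vec n \<psi>"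
  shows "0 \<le> subsys_var_all n k b d"
  using subsys_var_upper[OF assms, of "{}" d] trace_norm_nonneg[of "cfg {}"]
  by (smt (verit) card.empty empty_subsetI finite.emptyI finite_cfg zero_le)

lemma H2_nonneg:
  assumes "0 \<le> p" "p < 1"
  shows "0 \<le> H2 p"
proof (cases "p = 0")
  case True
  then show ?thesis by (simp add: H2_def)
next
  case False
  then have "p * log 2 p \<le> 0" "(1 - p) * log 2 (1 - p) \<le> 0"
    using assms by (auto intro!: mult_nonneg_nonpos simp: log_le_zero_cancel_iff)
  then show ?thesis by (simp add: H2_def)
qed


theorem theorem1:
  fixes n k d :: nat and b :: "nat \<Rightarrow> qvec" and \<delta> :: real and \<psi> :: qvec
  assumes code: "is_code n k b"
    and d: "d \<ge> 1"
    and delta: "\<delta> \<ge> 0"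
    and small: "subsys_var_all n k b d + \<delta> < 1"
    and entropy: "H2 (subsys_var_all n k b d / 2 + \<delta> / 2) < real k / real n"
    and psi_code: "in_code n k b \<psi>"
    and psi_unit: "unit_vec n \<psi>"
  shows "real (robust_complexity n \<delta> \<psi>) > log 2 (real d)"
proof (rule ccontr)
  let ?r = "subsys_var_all n k b d / 2 + \<delta> / 2"
  assume neg: "\<not> real (robust_complexity n \<delta> \<psi>) > log 2 (real d)"
  have r: "0 \<le> ?r" "?r < 1 / 2"
    using subsys_var_nonneg[OF code psi_code psi_unit, of d] delta small by auto
  have "0 \<le> H2 ?r"
    using r by (intro H2_nonneg) auto
  \<comment> \<open>A nonnegative entropy strictly below \<open>k / n\<close> rules out
    \<open>k = 0\<close>; with \<open>k < n\<close> there are at least two qubits, as universality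
    requires.\<close>
  then have "k \<noteq> 0"
    using entropy by (intro notI) simp
  then have n: "2 \<le> n" using code by (simp add: is_code_def)
  \<comment> \<open>The state \<open>\<psi>\<close> is within \<open>\<delta>\<close> of itself, so
    the LEAST in \<open>robust_complexity\<close> is attained by some
    \<open>\<psi>'\<close>.\<close>
  have "trace_norm (reg n) (\<lambda>x y. proj \<psi> x y - proj \<psi> x y) \<le> \<delta>"
    using trace_norm_le[of "reg n" "\<lambda>x y. proj \<psi> x y - proj \<psi> x y"] delta by simp
  then have "\<exists>l \<psi>'. unit_vec n \<psi>' \<and> trace_norm (reg n) (\<lambda>x y. proj \<psi>' x y - proj \<psi> x y) \<le> \<delta> \<and>
      circuit_complexity n \<psi>' = l"
    using psi_unit by blast
  from LeastI_ex[OF this] obtain \<psi>' where \<psi>': "unit_vec n \<psi>'"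
    "trace_norm (reg n) (\<lambda>x y. proj \<psi>' x y - proj \<psi> x y) \<le> \<delta>"
    "circuit_complexity n \<psi>' = robust_complexity n \<delta> \<psi>"
    unfolding robust_complexity_def by blast
  \<comment> \<open>Universality guarantees a circuit for \<open>\<psi>'\<close>, so the inner LEAST
    is attained too and yields an actual circuit of that depth.\<close>
  have "\<exists>l ls. length ls = l \<and> (\<forall>L\<in>set ls. valid_layer n L) \<and>
      (\<forall>x\<in>reg n. apply_circuit n ls ket0 x = \<psi>' x)"
    using preparable_unit_vec[OF n \<psi>'(1)] unfolding preparable_def by blast
  from LeastI_ex[OF this] obtain ls where ls: "length ls = circuit_complexity n \<psi>'"
    "\<forall>L\<in>set ls. valid_layer n L" "\<And>x. x \<in> reg n \<Longrightarrow> apply_circuit n ls ket0 x = \<psi>' x"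
    unfolding circuit_complexity_def by blast
  have "real (length ls) \<le> log 2 (real d)" using neg ls(1) \<psi>'(3) by simp
  then have "2 powr real (length ls) \<le> real d" using d by (simp add: le_log_iff)
  then have "real (2 ^ length ls) \<le> real d" by (simp add: powr_realpow)
  then have depth: "2 ^ length ls \<le> d" by (simp only: of_nat_le_iff)
  have gates: "\<forall>G\<in>set (concat ls). valid_gate n G"
    using ls(2) valid_layer_gates by auto
  have "real k \<le> real n * H2 ?r"
    by (rule min_entropy_le_marginals[OF unprep_dist_nonneg sum_unprep_dist[OF code gates]
          unprep_dist_le[OF code gates]
          unprep_dist_marginal[OF code psi_code psi_unit ls(2) depth ls(3) \<psi>'(2)] r])
  then show False using entropy n by (simp add: field_simps)
qed

end
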